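(* For every finite sequence of c.e. Turing degrees $\mathbf a_1,\mathbf a_2,\dots,\mathbf a_k$ ($k\ge 1$) there is a computable rigid structure $\mathcal A$ such that for every Turing degree $\mathbf x$: $\mathcal A$ is relatively $\mathbf x$-computably categorical if and only if $$\mathbf a_1\le\mathbf x\ \text{ or }\ \mathbf a_2\le\mathbf x\ \text{ or }\ \dots\ \text{ or }\ \mathbf a_k\le\mathbf x.$$
   Context: A c.e. degree is a Turing degree containing a c.e. set. Computable structures have domain $\omega$, a computable (possibly infinite) language, and a computable atomic diagram. A structure is rigid if it has no nontrivial automorphisms. For a Turing degree $\mathbf x$, a computable structure $\mathcal A$ is relatively $\mathbf x$-computably categorical if for every isomorphic copy $\mathcal B\cong\mathcal A$ (with domain $\omega$) there is a $(\deg(\mathcal B)\cup\mathbf x)$-computable isomorphism from $\mathcal B$ onto $\mathcal A$, where $\deg(\mathcal B)$ is the Turing degree of the atomic diagram of $\mathcal B$ and $\cup$ denotes the join of Turing degrees. *)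

theory Defs
  imports "HOL-Library.Nat_Bijection"
begin

section \<open>Oracle computability\<close>

text \<open>
  Programs for the partial functions on the natural numbers that are recursive in a set (the oracle),
  presented with unary functions only: several arguments are passed through the pairing function
  \<^const>\<open>prod_encode\<close>, whose inverses \<open>CFst\<close> and \<open>CSnd\<close> are basic programs.
\<close>

datatype program =
  CZero | CSucc | CFst | CSnd | COracle
| CPair program program
| CComp program program
| CPrec program program
| CMu program

text \<open>
  \<open>computes X p n m\<close>: with oracle \<open>X\<close>, the program \<open>p\<close> halts on input \<open>n\<close> with output \<open>m\<close>.
  In the rule for \<open>CMu\<close> the output is the least zero, and all earlier values are required to be
  defined, as usual for unbounded search.
\<close>

inductive computes :: "nat set \<Rightarrow> program \<Rightarrow> nat \<Rightarrow> nat \<Rightarrow> bool" for X :: "nat set" where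
  zero: "computes X CZero n 0"
| succ: "computes X CSucc n (Suc n)"
| fst: "computes X CFst (prod_encode (a, b)) a"
| snd: "computes X CSnd (prod_encode (a, b)) b"
| query: "computes X COracle n (if n \<in> X then 1 else 0)"
| pair: "computes X p n a \<Longrightarrow> computes X q n b \<Longrightarrow>
    computes X (CPair p q) n (prod_encode (a, b))"
| comp: "computes X q n k \<Longrightarrow> computes X p k m \<Longrightarrow> computes X (CComp p q) n m"
| prec_0: "computes X p a v \<Longrightarrow> computes X (CPrec p q) (prod_encode (a, 0)) v"
| prec_Suc: "computes X (CPrec p q) (prod_encode (a, n)) v \<Longrightarrow>
    computes X q (prod_encode (a, prod_encode (n, v))) w \<Longrightarrow>
    computes X (CPrec p q) (prod_encode (a, Suc n)) w"
| mu: "computes X p (prod_encode (a, m)) 0 \<Longrightarrow>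
    (\<And>i. i < m \<Longrightarrow> \<exists>v. computes X p (prod_encode (a, i)) (Suc v)) \<Longrightarrow>
    computes X (CMu p) a m"

inductive_cases CZeroE: "computes X CZero n m"
inductive_cases CSuccE: "computes X CSucc n m"
inductive_cases CFstE: "computes X CFst n m"
inductive_cases CSndE: "computes X CSnd n m"
inductive_cases COracleE: "computes X COracle n m"
inductive_cases CPairE: "computes X (CPair p q) n m"
inductive_cases CCompE: "computes X (CComp p q) n m"
inductive_cases CPrecE: "computes X (CPrec p q) n m"
inductive_cases CMuE: "computes X (CMu p) n m"

lemma computes_deterministic:
  "computes X p n m \<Longrightarrow> computes X p n m' \<Longrightarrow> m = m'"
proof (induction arbitrary: m' rule: computes.induct)
  case (mu p a m)
  from mu.prems obtain z: "computes X p (prod_encode (a, m')) 0"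
    and s: "\<And>i. i < m' \<Longrightarrow> \<exists>v. computes X p (prod_encode (a, i)) (Suc v)"
    by (elim CMuE) blast
  show ?case
  proof (rule ccontr)
    assume "m \<noteq> m'"
    then consider "m < m'" | "m' < m" by linarith
    then show False
    proof cases
      case 1
      with s obtain v where "computes X p (prod_encode (a, m)) (Suc v)" by blast
      with mu.IH(1) show False by blast
    next
      case 2
      with mu.IH(2) z show False by blast
    qed
  qed
next
  case (comp q n k p m)
  from comp.prems obtain k' where "computes X q n k'" "computes X p k' m'"
    by (rule CCompE)
  with comp.IH show ?case by metis
next
  case (pair p n a q b)
  from pair.prems obtain a' b' where "m' = prod_encode (a', b')" "computes X p n a'" "computes X q n b'"
    by (rule CPairE)
  with pair.IH show ?case by metis
next
  case (prec_0 p a v q)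
  from prec_0.prems have "computes X p a m'"
    by (rule CPrecE) simp_all
  with prec_0.IH show ?case by metis
next
  case (prec_Suc p q a n v w)
  from prec_Suc.prems obtain v' where "computes X (CPrec p q) (prod_encode (a, n)) v'"
    "computes X q (prod_encode (a, prod_encode (n, v'))) m'"
    by (rule CPrecE) simp_all
  with prec_Suc.IH show ?case by metis
next
  case (fst a b)
  then show ?case by (rule CFstE) simp
next
  case (snd a b)
  then show ?case by (rule CSndE) simp
next
  case (zero n)
  then show ?case by (rule CZeroE) simp
next
  case (succ n)
  then show ?case by (rule CSuccE) simp
next
  case (query n)
  then show ?case by (rule COracleE) simp
qed

definition computable_from :: "nat set \<Rightarrow> (nat \<Rightarrow> nat) \<Rightarrow> bool" where
  "computable_from X f \<longleftrightarrow> (\<exists>p. \<forall>n. computes X p n (f n))"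

definition turing_le :: "nat set \<Rightarrow> nat set \<Rightarrow> bool" where
  "turing_le A X \<longleftrightarrow> computable_from X (\<lambda>n. if n \<in> A then 1 else 0)"

abbreviation computable_fun :: "(nat \<Rightarrow> nat) \<Rightarrow> bool" where
  "computable_fun \<equiv> computable_from {}"

abbreviation computable_set :: "nat set \<Rightarrow> bool" where
  "computable_set A \<equiv> turing_le A {}"

definition ce_set :: "nat set \<Rightarrow> bool" where
  "ce_set W \<longleftrightarrow> (\<exists>p. W = {n. \<exists>m. computes {} p n m})"

definition turing_equiv :: "nat set \<Rightarrow> nat set \<Rightarrow> bool" where
  "turing_equiv A B \<longleftrightarrow> turing_le A B \<and> turing_le B A"

definition turing_join :: "nat set \<Rightarrow> nat set \<Rightarrow> nat set" where
  "turing_join A B = (\<lambda>n. 2 * n) ` A \<union> (\<lambda>n. 2 * n + 1) ` B"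

subsection \<open>Closure properties\<close>

lemma computable_from_id: "computable_from X (\<lambda>n. n)"
proof -
  have "computes X (CPair CFst CSnd) n n" for n
    using computes.pair[of X CFst n "fst (prod_decode n)" CSnd "snd (prod_decode n)"]
      computes.fst[of X "fst (prod_decode n)" "snd (prod_decode n)"]
      computes.snd[of X "fst (prod_decode n)" "snd (prod_decode n)"]
    by simp
  then show ?thesis unfolding computable_from_def by blast
qed

lemma computable_from_zero: "computable_from X (\<lambda>n. 0)"
  unfolding computable_from_def using computes.zero by blast

lemma computable_from_Suc: "computable_from X f \<Longrightarrow> computable_from X (\<lambda>n. Suc (f n))"
  unfolding computable_from_def using computes.comp computes.succ by blast

lemma computable_from_pair:
  "computable_from X f \<Longrightarrow> computable_from X g \<Longrightarrow> computable_from X (\<lambda>n. prod_encode (f n, g n))"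
  unfolding computable_from_def using computes.pair by blast

lemma computable_from_comp:
  "computable_from X f \<Longrightarrow> computable_from X g \<Longrightarrow> computable_from X (\<lambda>n. f (g n))"
  unfolding computable_from_def using computes.comp by blast

lemma computable_from_fst: "computable_from X (\<lambda>n. fst (prod_decode n))"
proof -
  have "computes X CFst n (fst (prod_decode n))" for n
    using computes.fst[of X "fst (prod_decode n)" "snd (prod_decode n)"] by simp
  then show ?thesis unfolding computable_from_def by blast
qed

lemma computable_from_snd: "computable_from X (\<lambda>n. snd (prod_decode n))"
proof -
  have "computes X CSnd n (snd (prod_decode n))" for n
    using computes.snd[of X "fst (prod_decode n)" "snd (prod_decode n)"] by simp
  then show ?thesis unfolding computable_from_def by blast
qed

lemma computable_from_rec:
  assumes f: "computable_from X f" and g: "computable_from X g"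
    and a: "computable_from X a" and t: "computable_from X t"
  shows "computable_from X
    (\<lambda>x. rec_nat (f (a x)) (\<lambda>i v. g (prod_encode (a x, prod_encode (i, v)))) (t x))"
proof -
  obtain p q where p: "\<And>n. computes X p n (f n)" and q: "\<And>n. computes X q n (g n)"
    using f g unfolding computable_from_def by blast
  let ?h = "\<lambda>b n. rec_nat (f b) (\<lambda>i v. g (prod_encode (b, prod_encode (i, v)))) n"
  have h: "computes X (CPrec p q) (prod_encode (b, n)) (?h b n)" for b n
    by (induction n) (use p q in \<open>auto intro: computes.prec_0 computes.prec_Suc\<close>)
  obtain r where r: "\<And>x. computes X r x (prod_encode (a x, t x))"
    using computable_from_pair[OF a t] unfolding computable_from_def by blast
  have "computes X (CComp (CPrec p q) r) x (?h (a x) (t x))" for x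
    using computes.comp[OF r h] .
  then show ?thesis unfolding computable_from_def by blast
qed

lemma computable_from_if:
  assumes c: "computable_from X c" and f: "computable_from X f" and g: "computable_from X g"
  shows "computable_from X (\<lambda>x. if c x = 0 then f x else g x)"
proof -
  have "(\<lambda>x. if c x = 0 then f x else g x) =
      (\<lambda>x. rec_nat (f x) (\<lambda>i v. g (fst (prod_decode (prod_encode (x, prod_encode (i, v)))))) (c x))"
  proof
    fix x
    show "(if c x = 0 then f x else g x) =
      rec_nat (f x) (\<lambda>i v. g (fst (prod_decode (prod_encode (x, prod_encode (i, v)))))) (c x)"
      by (cases "c x") simp_all
  qed
  with computable_from_rec[OF f computable_from_comp[OF g computable_from_fst] computable_from_id c]
  show ?thesis by simp
qed

lemma computable_from_simple_rec:
  assumes g: "computable_from X (\<lambda>n. g (fst (prod_decode n)) (snd (prod_decode n)))"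
  shows "computable_from X (rec_nat 0 g)"
  using computable_from_rec[OF computable_from_zero computable_from_comp[OF g computable_from_snd]
      computable_from_zero computable_from_id]
  by simp

lemma computable_from_parity: "computable_from X (\<lambda>n. n mod 2)"
proof -
  let ?g = "\<lambda>i v. if v = 0 then Suc 0 else 0"
  have "computable_from X (rec_nat 0 ?g)"
    by (rule computable_from_simple_rec, rule computable_from_if)
      (rule computable_from_snd computable_from_Suc computable_from_zero)+
  moreover have "rec_nat 0 ?g n = n mod 2" for n :: nat
    by (induction n) (auto simp: mod_Suc)
  then have "rec_nat 0 ?g = (\<lambda>n. n mod 2)" by (rule ext)
  ultimately show ?thesis by (simp only:)
qed

lemma computable_from_half: "computable_from X (\<lambda>n. n div 2)"
proof -
  let ?g = "\<lambda>i v. if i mod 2 = 0 then v else Suc v"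
  have "computable_from X (rec_nat 0 ?g)"
    by (rule computable_from_simple_rec, rule computable_from_if)
      (rule computable_from_comp[OF computable_from_parity computable_from_fst]
        computable_from_Suc computable_from_snd)+
  moreover have "rec_nat 0 ?g n = n div 2" for n :: nat
    by (induction n) (auto simp: div_Suc mod_Suc)
  then have "rec_nat 0 ?g = (\<lambda>n. n div 2)" by (rule ext)
  ultimately show ?thesis by (simp only:)
qed

lemma computable_from_double: "computable_from X (\<lambda>n. 2 * n)"
proof -
  let ?g = "\<lambda>i v. Suc (Suc v)"
  have "computable_from X (rec_nat 0 ?g)"
    by (rule computable_from_simple_rec) (rule computable_from_Suc computable_from_snd)+
  moreover have "rec_nat 0 ?g n = 2 * n" for n :: nat
    by (induction n) auto
  then have "rec_nat 0 ?g = (\<lambda>n. 2 * n)" by (rule ext)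
  ultimately show ?thesis by (simp only:)
qed

subsection \<open>Turing reducibility\<close>

primrec subst_oracle :: "program \<Rightarrow> program \<Rightarrow> program" where
  "subst_oracle r CZero = CZero"
| "subst_oracle r CSucc = CSucc"
| "subst_oracle r CFst = CFst"
| "subst_oracle r CSnd = CSnd"
| "subst_oracle r COracle = r"
| "subst_oracle r (CPair p q) = CPair (subst_oracle r p) (subst_oracle r q)"
| "subst_oracle r (CComp p q) = CComp (subst_oracle r p) (subst_oracle r q)"
| "subst_oracle r (CPrec p q) = CPrec (subst_oracle r p) (subst_oracle r q)"
| "subst_oracle r (CMu p) = CMu (subst_oracle r p)"

lemma computes_subst_oracle:
  assumes "\<And>n. computes X r n (if n \<in> Y then 1 else 0)"
  shows "computes Y p n m \<Longrightarrow> computes X (subst_oracle r p) n m"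
proof (induction rule: computes.induct)
  case (query n)
  then show ?case using assms by simp
next
  case (mu p a m)
  then show ?case by (auto intro!: computes.mu)
qed (auto intro: computes.intros simp del: One_nat_def)

lemma computable_from_trans:
  "turing_le Y X \<Longrightarrow> computable_from Y f \<Longrightarrow> computable_from X f"
  unfolding turing_le_def computable_from_def using computes_subst_oracle by blast

lemma turing_le_refl: "turing_le A A"
  unfolding turing_le_def computable_from_def using computes.query by blast

lemma turing_le_trans: "turing_le A B \<Longrightarrow> turing_le B C \<Longrightarrow> turing_le A C"
  using computable_from_trans unfolding turing_le_def by blast

lemma turing_equiv_equivp: "equivp turing_equiv"
proof (rule equivpI)
  show "reflp turing_equiv" unfolding reflp_def turing_equiv_def using turing_le_refl by blast
  show "symp turing_equiv" unfolding symp_def turing_equiv_def by blast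
  show "transp turing_equiv" unfolding transp_def turing_equiv_def using turing_le_trans by blast
qed

lemma turing_join_iff:
  "n \<in> turing_join A B \<longleftrightarrow> (if even n then n div 2 \<in> A else n div 2 \<in> B)"
  unfolding turing_join_def image_iff by (cases "even n") (auto elim!: evenE oddE, presburger+)

lemma turing_le_join1: "turing_le A (turing_join A B)"
  using computable_from_comp[OF turing_le_refl[unfolded turing_le_def] computable_from_double,
      of "turing_join A B"]
  unfolding turing_le_def by (simp add: turing_join_iff)

lemma turing_le_join2: "turing_le B (turing_join A B)"
  using computable_from_comp[OF turing_le_refl[unfolded turing_le_def]
      computable_from_Suc[OF computable_from_double], of "turing_join A B"]
  unfolding turing_le_def by (simp add: turing_join_iff)

lemma turing_join_least:
  assumes "turing_le A C" "turing_le B C"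
  shows "turing_le (turing_join A B) C"
proof -
  have "computable_from C (\<lambda>n. if n mod 2 = 0 then (if n div 2 \<in> A then 1 else 0)
      else (if n div 2 \<in> B then 1 else 0))"
    using assms unfolding turing_le_def
    by (intro computable_from_if computable_from_parity
        computable_from_comp[OF _ computable_from_half])
  also have "(\<lambda>n. if n mod 2 = 0 then (if n div 2 \<in> A then 1 else 0)
      else (if n div 2 \<in> B then 1 else 0)) = (\<lambda>n. if n \<in> turing_join A B then 1 else (0::nat))"
    by (auto simp: fun_eq_iff turing_join_iff even_iff_mod_2_eq_zero)
  finally show ?thesis unfolding turing_le_def .
qed

section \<open>Turing degrees\<close>

text \<open>
  The order is Turing reducibility and \<^const>\<open>sup\<close> is the join of degrees.
\<close>

quotient_type turing_degree = "nat set" / turing_equiv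
  morphisms rep_turing_degree turing_degree_of
  by (rule turing_equiv_equivp)

instantiation turing_degree :: semilattice_sup
begin

lift_definition less_eq_turing_degree :: "turing_degree \<Rightarrow> turing_degree \<Rightarrow> bool" is turing_le
  by (meson turing_equiv_def turing_le_trans)

definition less_turing_degree :: "turing_degree \<Rightarrow> turing_degree \<Rightarrow> bool" where
  "less_turing_degree a b \<longleftrightarrow> a \<le> b \<and> \<not> b \<le> a"

lift_definition sup_turing_degree :: "turing_degree \<Rightarrow> turing_degree \<Rightarrow> turing_degree"
  is turing_join
  by (meson turing_equiv_def turing_join_least turing_le_join1 turing_le_join2 turing_le_trans)

instance
proof
  fix a b c :: turing_degree
  show "a < b \<longleftrightarrow> a \<le> b \<and> \<not> b \<le> a" by (rule less_turing_degree_def)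
  show "a \<le> a" by transfer (rule turing_le_refl)
  show "a \<le> b \<Longrightarrow> b \<le> c \<Longrightarrow> a \<le> c" by transfer (rule turing_le_trans)
  show "a \<le> b \<Longrightarrow> b \<le> a \<Longrightarrow> a = b" by transfer (simp add: turing_equiv_def)
  show "a \<le> sup a b" by transfer (rule turing_le_join1)
  show "b \<le> sup a b" by transfer (rule turing_le_join2)
  show "b \<le> a \<Longrightarrow> c \<le> a \<Longrightarrow> sup b c \<le> a" by transfer (rule turing_join_least)
qed

end

definition ce_degree :: "turing_degree \<Rightarrow> bool" where
  "ce_degree d \<longleftrightarrow> (\<exists>W. ce_set W \<and> d = turing_degree_of W)"

lift_definition degree_computable :: "turing_degree \<Rightarrow> (nat \<Rightarrow> nat) \<Rightarrow> bool" is computable_from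
  unfolding turing_equiv_def fun_eq_iff using computable_from_trans by metis

section \<open>Structures with domain the natural numbers\<close>

text \<open>
  Symbols are natural numbers; an arity map sends a symbol to its arity and a number that is not a
  symbol to \<^const>\<open>None\<close>. Constant symbols are function symbols of arity 0.
\<close>

record language =
  rel_arity :: "nat \<Rightarrow> nat option"
  fun_arity :: "nat \<Rightarrow> nat option"

definition computable_arity :: "(nat \<Rightarrow> nat option) \<Rightarrow> bool" where
  "computable_arity ar \<longleftrightarrow>
    computable_set {s. ar s \<noteq> None} \<and>
    (\<exists>p. \<forall>s n. ar s = Some n \<longrightarrow> computes {} p s n)"

definition computable_language :: "language \<Rightarrow> bool" where
  "computable_language L \<longleftrightarrow> computable_arity (rel_arity L) \<and> computable_arity (fun_arity L)"

text \<open>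
  The interpretations are total on all symbols and argument lists; the values outside the language
  or at lists of the wrong length play no role in any notion below.
\<close>

record struc =
  rel_interp :: "nat \<Rightarrow> nat list \<Rightarrow> bool"
  fun_interp :: "nat \<Rightarrow> nat list \<Rightarrow> nat"

subsection \<open>Atomic diagrams\<close>

text \<open>
  Closed terms and atomic sentences of the language expanded by a name for every element of the
  domain; the literals are the atomic sentences and their negations.
\<close>

datatype cterm = Elem nat | App nat "cterm list"

datatype atomic = Equal cterm cterm | Rel nat "cterm list"

datatype literal = Pos atomic | Neg atomic

primrec wf_cterm :: "language \<Rightarrow> cterm \<Rightarrow> bool" where
  "wf_cterm L (Elem a) \<longleftrightarrow> True"
| "wf_cterm L (App f ts) \<longleftrightarrow> fun_arity L f = Some (length ts) \<and> list_all (wf_cterm L) ts"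

primrec wf_atomic :: "language \<Rightarrow> atomic \<Rightarrow> bool" where
  "wf_atomic L (Equal s t) \<longleftrightarrow> wf_cterm L s \<and> wf_cterm L t"
| "wf_atomic L (Rel r ts) \<longleftrightarrow> rel_arity L r = Some (length ts) \<and> list_all (wf_cterm L) ts"

primrec wf_literal :: "language \<Rightarrow> literal \<Rightarrow> bool" where
  "wf_literal L (Pos \<phi>) \<longleftrightarrow> wf_atomic L \<phi>"
| "wf_literal L (Neg \<phi>) \<longleftrightarrow> wf_atomic L \<phi>"

primrec cterm_value :: "struc \<Rightarrow> cterm \<Rightarrow> nat" where
  "cterm_value A (Elem a) = a"
| "cterm_value A (App f ts) = fun_interp A f (map (cterm_value A) ts)"

primrec holds_atomic :: "struc \<Rightarrow> atomic \<Rightarrow> bool" where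
  "holds_atomic A (Equal s t) \<longleftrightarrow> cterm_value A s = cterm_value A t"
| "holds_atomic A (Rel r ts) \<longleftrightarrow> rel_interp A r (map (cterm_value A) ts)"

primrec holds_literal :: "struc \<Rightarrow> literal \<Rightarrow> bool" where
  "holds_literal A (Pos \<phi>) \<longleftrightarrow> holds_atomic A \<phi>"
| "holds_literal A (Neg \<phi>) \<longleftrightarrow> \<not> holds_atomic A \<phi>"

primrec cterm_code :: "cterm \<Rightarrow> nat" where
  "cterm_code (Elem a) = prod_encode (0, a)"
| "cterm_code (App f ts) = prod_encode (1, prod_encode (f, list_encode (map cterm_code ts)))"

primrec atomic_code :: "atomic \<Rightarrow> nat" where
  "atomic_code (Equal s t) = prod_encode (0, prod_encode (cterm_code s, cterm_code t))"
| "atomic_code (Rel r ts) = prod_encode (1, prod_encode (r, list_encode (map cterm_code ts)))"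

primrec literal_code :: "literal \<Rightarrow> nat" where
  "literal_code (Pos \<phi>) = prod_encode (0, atomic_code \<phi>)"
| "literal_code (Neg \<phi>) = prod_encode (1, atomic_code \<phi>)"

lemma cterm_code_inject: "cterm_code s = cterm_code t \<Longrightarrow> s = t"
proof (induction s arbitrary: t)
  case (Elem a)
  then show ?case by (cases t) auto
next
  case (App f ts)
  then obtain us where t: "t = App f us" and eq: "map cterm_code ts = map cterm_code us"
    by (cases t) (auto simp: list_encode_eq)
  from eq App.IH have "ts = us"
    by (induction ts arbitrary: us) (auto simp: map_eq_Cons_conv Cons_eq_map_conv)
  with t show ?case by simp
qed

lemma literal_code_inject: "literal_code \<phi> = literal_code \<psi> \<longleftrightarrow> \<phi> = \<psi>"
proof -
  have "ts = us" if "map cterm_code ts = map cterm_code us" for ts us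
    using that cterm_code_inject by (metis injI inj_map_eq_map)
  then have "atomic_code a = atomic_code b \<Longrightarrow> a = b" for a b
    by (cases a; cases b) (auto dest: cterm_code_inject simp: list_encode_eq)
  then show ?thesis by (cases \<phi>; cases \<psi>) auto
qed

definition atomic_diagram :: "language \<Rightarrow> struc \<Rightarrow> nat set" where
  "atomic_diagram L A = literal_code ` {\<phi>. wf_literal L \<phi> \<and> holds_literal A \<phi>}"

definition computable_structure :: "language \<Rightarrow> struc \<Rightarrow> bool" where
  "computable_structure L A \<longleftrightarrow> computable_language L \<and> computable_set (atomic_diagram L A)"

definition structure_degree :: "language \<Rightarrow> struc \<Rightarrow> turing_degree" where
  "structure_degree L B = turing_degree_of (atomic_diagram L B)"

subsection \<open>Isomorphisms and relative categoricity\<close>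

definition is_isomorphism :: "language \<Rightarrow> struc \<Rightarrow> struc \<Rightarrow> (nat \<Rightarrow> nat) \<Rightarrow> bool" where
  "is_isomorphism L B A h \<longleftrightarrow> bij h \<and>
    (\<forall>r xs. rel_arity L r = Some (length xs) \<longrightarrow>
      (rel_interp B r xs \<longleftrightarrow> rel_interp A r (map h xs))) \<and>
    (\<forall>f xs. fun_arity L f = Some (length xs) \<longrightarrow>
      h (fun_interp B f xs) = fun_interp A f (map h xs))"

definition isomorphic_structures :: "language \<Rightarrow> struc \<Rightarrow> struc \<Rightarrow> bool" where
  "isomorphic_structures L B A \<longleftrightarrow> (\<exists>h. is_isomorphism L B A h)"

definition rigid_structure :: "language \<Rightarrow> struc \<Rightarrow> bool" where
  "rigid_structure L A \<longleftrightarrow> (\<forall>h. is_isomorphism L A A h \<longrightarrow> h = id)"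

definition relatively_computably_categorical ::
  "turing_degree \<Rightarrow> language \<Rightarrow> struc \<Rightarrow> bool" where
  "relatively_computably_categorical x L A \<longleftrightarrow>
    (\<forall>B. isomorphic_structures L B A \<longrightarrow>
      (\<exists>h. degree_computable (sup (structure_degree L B) x) h \<and> is_isomorphism L B A h))"

end

theory Submission
  imports Defs "HOL-Library.Sublist"
begin

text \<open>
  Let \<open>W\<^sub>i\<close>, \<open>i < k\<close>, be c.e. sets in the given degrees. The structure has a component for every
  \<open>k\<close>-tuple, with two base elements which any single truth value \<open>n\<^sub>i \<in> W\<^sub>i\<close> tells apart: there are
  existential formulas, one that is right if \<open>n\<^sub>i \<notin> W\<^sub>i\<close> and one that is right if \<open>n\<^sub>i \<in> W\<^sub>i\<close>, for every
  \<open>i\<close>. Hence computing some \<open>W\<^sub>i\<close> suffices for computing the isomorphism from any copy.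

  Conversely, if for a sufficiently generic copy the isomorphism is computable from the copy and
  \<open>X\<close>, then \<open>X\<close> enumerates, by searching through finite parts of copies, a set of tuples which contains the
  product of the complements of the \<open>W\<^sub>i\<close> and is disjoint from the product of the \<open>W\<^sub>i\<close>. Such a set
  exists only if \<open>X\<close> computes one of the \<open>W\<^sub>i\<close>.
\<close>

section \<open>Computable functions and decidable predicates\<close>

abbreviation pfst :: "nat \<Rightarrow> nat" where "pfst z \<equiv> fst (prod_decode z)"
abbreviation psnd :: "nat \<Rightarrow> nat" where "psnd z \<equiv> snd (prod_decode z)"

definition decidable_from :: "nat set \<Rightarrow> (nat \<Rightarrow> bool) \<Rightarrow> bool" where
  "decidable_from X P \<longleftrightarrow> computable_from X (\<lambda>n. if P n then 1 else 0)"

lemma turing_le_iff_decidable: "turing_le A X \<longleftrightarrow> decidable_from X (\<lambda>n. n \<in> A)"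
  by (simp add: turing_le_def decidable_from_def)

named_theorems computable_intros

lemma computable_const [computable_intros]: "computable_from X (\<lambda>n. c)"
  by (induction c) (auto intro: computable_from_zero computable_from_Suc)

lemmas [computable_intros] = computable_from_id computable_from_Suc computable_from_pair
  computable_from_comp[OF computable_from_fst] computable_from_comp[OF computable_from_snd]
  computable_from_comp[OF computable_from_half]

lemma computable_if [computable_intros]:
  assumes "decidable_from X P" "computable_from X f" "computable_from X g"
  shows "computable_from X (\<lambda>x. if P x then f x else g x)"
  using computable_from_if[OF assms(1)[unfolded decidable_from_def] assms(3,2)]
  by (rule back_subst[of "computable_from X"]) auto

lemma decidable_comp: "decidable_from X P \<Longrightarrow> computable_from X f \<Longrightarrow> decidable_from X (\<lambda>x. P (f x))"
  unfolding decidable_from_def by (rule computable_from_comp)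

lemma decidable_const [computable_intros]: "decidable_from X (\<lambda>n. b)"
  unfolding decidable_from_def by (rule computable_const)

lemma decidable_if [computable_intros]:
  assumes "decidable_from X P" "decidable_from X Q" "decidable_from X R"
  shows "decidable_from X (\<lambda>x. if P x then Q x else R x)"
  using computable_if[OF assms(1) assms(2,3)[unfolded decidable_from_def]]
  unfolding decidable_from_def by (rule back_subst[of "computable_from X"]) auto

lemma decidable_not [computable_intros]:
  assumes "decidable_from X P"
  shows "decidable_from X (\<lambda>x. \<not> P x)"
  using computable_from_if[OF assms[unfolded decidable_from_def] computable_const[of X 1]
      computable_const[of X 0]]
  unfolding decidable_from_def by (rule back_subst[of "computable_from X"]) auto

lemma decidable_conj [computable_intros]:
  "decidable_from X P \<Longrightarrow> decidable_from X Q \<Longrightarrow> decidable_from X (\<lambda>x. P x \<and> Q x)"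
  using decidable_if[OF _ _ decidable_const[of X False], of P Q] by (simp add: if_bool_eq_disj)

lemma decidable_disj [computable_intros]:
  "decidable_from X P \<Longrightarrow> decidable_from X Q \<Longrightarrow> decidable_from X (\<lambda>x. P x \<or> Q x)"
  using decidable_not[OF decidable_conj[OF decidable_not decidable_not], of X P Q] by simp

lemma decidable_imp [computable_intros]:
  "decidable_from X P \<Longrightarrow> decidable_from X Q \<Longrightarrow> decidable_from X (\<lambda>x. P x \<longrightarrow> Q x)"
  unfolding imp_conv_disj by (intro decidable_disj decidable_not)

lemma computable_rec [computable_intros]:
  assumes "computable_from X f"
    and "computable_from X (\<lambda>z. g (pfst z) (pfst (psnd z)) (psnd (psnd z)))"
    and "computable_from X t"
  shows "computable_from X (\<lambda>x. rec_nat (f x) (\<lambda>i v. g x i v) (t x))"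
  using computable_from_rec[OF assms(1,2) computable_from_id assms(3)] by simp

lemma computable_pred [computable_intros]:
  assumes "computable_from X f"
  shows "computable_from X (\<lambda>x. f x - 1)"
proof -
  have "rec_nat 0 (\<lambda>i v. i) n = n - 1" for n :: nat by (cases n) auto
  moreover have "computable_from X (\<lambda>x. rec_nat 0 (\<lambda>i v. i) (f x))"
    by (intro computable_intros assms)
  ultimately show ?thesis by simp
qed

lemma computable_diff [computable_intros]:
  assumes "computable_from X f" "computable_from X g"
  shows "computable_from X (\<lambda>x. f x - g x)"
proof -
  have "rec_nat m (\<lambda>i v. v - 1) n = m - n" for m n :: nat by (induction n) auto
  moreover have "computable_from X (\<lambda>x. rec_nat (f x) (\<lambda>i v. v - 1) (g x))"
    by (intro computable_intros assms)
  ultimately show ?thesis by simp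
qed

lemma decidable_zero:
  assumes "computable_from X f"
  shows "decidable_from X (\<lambda>x. f x = 0)"
  unfolding decidable_from_def
  by (intro computable_from_if computable_const assms)

lemma decidable_le [computable_intros]:
  "computable_from X f \<Longrightarrow> computable_from X g \<Longrightarrow> decidable_from X (\<lambda>x. f x \<le> g x)"
  using decidable_zero[OF computable_diff, of X f g] by simp

lemma decidable_less [computable_intros]:
  "computable_from X f \<Longrightarrow> computable_from X g \<Longrightarrow> decidable_from X (\<lambda>x. f x < g x)"
  using decidable_le[OF computable_from_Suc, of X f g] by (simp add: Suc_le_eq)

lemma decidable_eq [computable_intros]:
  "computable_from X f \<Longrightarrow> computable_from X g \<Longrightarrow> decidable_from X (\<lambda>x. f x = g x)"
  using decidable_conj[OF decidable_le decidable_le, of X f g g f] by (simp add: order_eq_iff)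

lemma decidable_all_less [computable_intros]:
  assumes "decidable_from X (\<lambda>z. P (pfst z) (psnd z))" "computable_from X t"
  shows "decidable_from X (\<lambda>x. \<forall>i<t x. P x i)"
proof -
  have "rec_nat 1 (\<lambda>i v. if P x i then v else 0) n = (if \<forall>i<n. P x i then 1 else (0::nat))" for x n
    by (induction n) (auto simp: less_Suc_eq)
  moreover have "decidable_from X (\<lambda>z. P (pfst z) (pfst (psnd z)))"
    using decidable_comp[OF assms(1), of "\<lambda>z. prod_encode (pfst z, pfst (psnd z))"]
    by (simp add: computable_intros)
  then have "computable_from X (\<lambda>x. rec_nat 1 (\<lambda>i v. if P x i then v else 0) (t x))"
    by (intro computable_intros assms(2))
  ultimately show ?thesis unfolding decidable_from_def by (simp only:)
qed

lemma computable_Least: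
  assumes "decidable_from X (\<lambda>z. P (pfst z) (psnd z))" and ex: "\<And>x. \<exists>m. P x m"
  shows "computable_from X (\<lambda>x. LEAST m. P x m)"
proof -
  \<comment> \<open>\<open>CMu\<close> looks for a zero, so truth is coded by 0 here, unlike in
    \<open>decidable_from\<close>.\<close>
  have "computable_from X (\<lambda>z. if P (pfst z) (psnd z) then 0 else Suc 0)"
    by (intro computable_intros assms)
  then obtain p where p: "\<And>z. computes X p z (if P (pfst z) (psnd z) then 0 else Suc 0)"
    unfolding computable_from_def by blast
  have "computes X (CMu p) x (LEAST m. P x m)" for x
  proof (rule computes.mu)
    show "computes X p (prod_encode (x, LEAST m. P x m)) 0"
      using p[of "prod_encode (x, LEAST m. P x m)"] LeastI_ex[OF ex[of x]] by simp
    show "\<exists>v. computes X p (prod_encode (x, i)) (Suc v)" if "i < (LEAST m. P x m)" for i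
      using p[of "prod_encode (x, i)"] not_less_Least[OF that] by auto
  qed
  then show ?thesis unfolding computable_from_def by blast
qed

lemma computable_from_mono: "computable_from {} f \<Longrightarrow> computable_from X f"
  using computable_from_trans[of "{}" X] computable_from_zero[of X] by (simp add: turing_le_def)

lemma decidable_from_mono: "decidable_from {} P \<Longrightarrow> decidable_from X P"
  unfolding decidable_from_def by (rule computable_from_mono)

text \<open>No procedure uniform in \<open>i\<close> is assumed: the induction on \<open>k\<close>
  builds a case distinction with one branch for each of the finitely many indices.\<close>

lemma decidable_case_less:
  assumes "\<And>i. i < k \<Longrightarrow> decidable_from X (P i)" and f: "computable_from X f"
  shows "decidable_from X (\<lambda>x. f x < k \<and> P (f x) x)"
  using assms(1)
proof (induction k)
  case 0
  then show ?case by (simp add: decidable_const)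
next
  case (Suc k)
  have "decidable_from X (\<lambda>x. (f x < k \<and> P (f x) x) \<or> (f x = k \<and> P k x))"
    by (intro decidable_disj Suc.IH Suc.prems decidable_conj decidable_eq f computable_const) auto
  also have "(\<lambda>x. (f x < k \<and> P (f x) x) \<or> (f x = k \<and> P k x)) = (\<lambda>x. f x < Suc k \<and> P (f x) x)"
    by (auto simp: less_Suc_eq)
  finally show ?case .
qed

section \<open>Semidecidable predicates\<close>

text \<open>Relative Sigma_1 form. Closure under conjunction and existential quantification then
  amounts to pairing witnesses.\<close>

definition semidecidable_from :: "nat set \<Rightarrow> (nat \<Rightarrow> bool) \<Rightarrow> bool" where
  "semidecidable_from X P \<longleftrightarrow>
    (\<exists>R. decidable_from X (\<lambda>z. R (pfst z) (psnd z)) \<and> (\<forall>n. P n \<longleftrightarrow> (\<exists>s. R n s)))"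

lemma semidecidableI:
  "decidable_from X (\<lambda>z. R (pfst z) (psnd z)) \<Longrightarrow> (\<And>n. P n \<longleftrightarrow> (\<exists>s. R n s)) \<Longrightarrow>
    semidecidable_from X P"
  unfolding semidecidable_from_def by blast

lemma decidable_comp2:
  assumes "decidable_from X (\<lambda>z. R (pfst z) (psnd z))" "computable_from X f" "computable_from X g"
  shows "decidable_from X (\<lambda>x. R (f x) (g x))"
  using decidable_comp[OF assms(1) computable_from_pair[OF assms(2,3)]] by simp

lemma semidecidable_from_mono:
  "semidecidable_from {} P \<Longrightarrow> semidecidable_from X P"
  unfolding semidecidable_from_def using decidable_from_mono by blast

lemma semidecidable_const: "semidecidable_from X (\<lambda>n. b)"
  by (rule semidecidableI[where R = "\<lambda>_ _. b"]) (auto intro: computable_intros)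

lemma semidecidable_comp:
  assumes "semidecidable_from X P" "computable_from X f"
  shows "semidecidable_from X (\<lambda>x. P (f x))"
proof -
  obtain R where R: "decidable_from X (\<lambda>z. R (pfst z) (psnd z))" "\<And>n. P n \<longleftrightarrow> (\<exists>s. R n s)"
    using assms(1) unfolding semidecidable_from_def by blast
  show ?thesis
    by (rule semidecidableI[where R = "\<lambda>n s. R (f n) s"])
      (intro decidable_comp2[OF R(1)] computable_from_comp[OF assms(2)] computable_intros, simp add: R(2))
qed

lemma semidecidable_conj:
  assumes "semidecidable_from X P" "semidecidable_from X Q"
  shows "semidecidable_from X (\<lambda>x. P x \<and> Q x)"
proof -
  obtain R S where R: "decidable_from X (\<lambda>z. R (pfst z) (psnd z))" "\<And>n. P n \<longleftrightarrow> (\<exists>s. R n s)"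
    and S: "decidable_from X (\<lambda>z. S (pfst z) (psnd z))" "\<And>n. Q n \<longleftrightarrow> (\<exists>s. S n s)"
    using assms unfolding semidecidable_from_def by blast
  show ?thesis
  proof (rule semidecidableI[where R = "\<lambda>n s. R n (pfst s) \<and> S n (psnd s)"])
    show "(P n \<and> Q n) \<longleftrightarrow> (\<exists>s. R n (pfst s) \<and> S n (psnd s))" for n
      unfolding R(2) S(2) by (metis fst_conv snd_conv prod_encode_inverse)
  qed (intro decidable_comp2[OF R(1)] decidable_comp2[OF S(1)] computable_intros)
qed

lemma semidecidable_ex:
  assumes "semidecidable_from X (\<lambda>z. P (pfst z) (psnd z))"
  shows "semidecidable_from X (\<lambda>n. \<exists>m. P n m)"
proof -
  obtain R where R: "decidable_from X (\<lambda>z. R (pfst z) (psnd z))"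
      "\<And>z. P (pfst z) (psnd z) \<longleftrightarrow> (\<exists>s. R z s)"
    using assms unfolding semidecidable_from_def by blast
  have R': "P n m \<longleftrightarrow> (\<exists>s. R (prod_encode (n, m)) s)" for n m
    using R(2)[of "prod_encode (n, m)"] by simp
  show ?thesis
  proof (rule semidecidableI[where R = "\<lambda>n s. R (prod_encode (n, pfst s)) (psnd s)"])
    show "(\<exists>m. P n m) \<longleftrightarrow> (\<exists>s. R (prod_encode (n, pfst s)) (psnd s))" for n
      unfolding R' by (metis fst_conv snd_conv prod_encode_inverse)
  qed (intro decidable_comp2[OF R(1)] computable_intros)
qed

lemma semidecidable_all_less:
  fixes k :: nat
  assumes "\<And>i. i < k \<Longrightarrow> semidecidable_from X (P i)"
  shows "semidecidable_from X (\<lambda>n. \<forall>i<k. P i n)"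
  using assms
proof (induction k)
  case 0
  then show ?case by (simp add: semidecidable_const)
next
  case (Suc k)
  then have "semidecidable_from X (\<lambda>n. (\<forall>i<k. P i n) \<and> P k n)"
    by (intro semidecidable_conj) auto
  then show ?case by (simp add: less_Suc_eq all_conj_distrib imp_disjL conj_commute)
qed

text \<open>Search for witnesses of \<open>P\<close> and of its negation at once; the first stage at
  which either appears settles the matter.\<close>

lemma Post:
  assumes "semidecidable_from X P" "semidecidable_from X (\<lambda>n. \<not> P n)"
  shows "decidable_from X P"
proof -
  obtain R S where R: "decidable_from X (\<lambda>z. R (pfst z) (psnd z))" "\<And>n. P n \<longleftrightarrow> (\<exists>s. R n s)"
    and S: "decidable_from X (\<lambda>z. S (pfst z) (psnd z))" "\<And>n. \<not> P n \<longleftrightarrow> (\<exists>s. S n s)"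
    using assms unfolding semidecidable_from_def by blast
  let ?m = "\<lambda>n. LEAST s. R n s \<or> S n s"
  have ex: "\<exists>s. R n s \<or> S n s" for n using R(2) S(2) by blast
  have m: "computable_from X ?m"
    by (rule computable_Least[OF decidable_disj[OF R(1) S(1)] ex])
  have "P n \<longleftrightarrow> R n (?m n)" for n
    using LeastI_ex[OF ex[of n]] R(2) S(2) by blast
  moreover have "decidable_from X (\<lambda>n. R n (?m n))"
    by (intro decidable_comp2[OF R(1)] m computable_intros)
  ultimately show ?thesis by presburger
qed

section \<open>Computations with a partially known oracle\<close>

text \<open>
  A partial oracle answers a query with 0 if the answer is unknown, and otherwise with the successor
  of the answer; the same convention is used for the outcome of a computation. The number \<open>s\<close>
  only bounds the unbounded searches, whose loop carries the state 0 while it is running, 1 when it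
  is stuck, and \<open>m + 2\<close> when it has found \<open>m\<close>.
\<close>

primrec run :: "(nat \<Rightarrow> nat) \<Rightarrow> nat \<Rightarrow> program \<Rightarrow> nat \<Rightarrow> nat" where
  "run \<alpha> s CZero = (\<lambda>n. Suc 0)"
| "run \<alpha> s CSucc = (\<lambda>n. Suc (Suc n))"
| "run \<alpha> s CFst = (\<lambda>n. Suc (pfst n))"
| "run \<alpha> s CSnd = (\<lambda>n. Suc (psnd n))"
| "run \<alpha> s COracle = (\<lambda>n. \<alpha> n)"
| "run \<alpha> s (CPair p q) = (\<lambda>n. if run \<alpha> s p n = 0 \<or> run \<alpha> s q n = 0 then 0
     else Suc (prod_encode (run \<alpha> s p n - 1, run \<alpha> s q n - 1)))"
| "run \<alpha> s (CComp p q) = (\<lambda>n. if run \<alpha> s q n = 0 then 0 else run \<alpha> s p (run \<alpha> s q n - 1))"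
| "run \<alpha> s (CPrec p q) = (\<lambda>n. rec_nat (run \<alpha> s p (pfst n))
     (\<lambda>i v. if v = 0 then 0 else run \<alpha> s q (prod_encode (pfst n, prod_encode (i, v - 1)))) (psnd n))"
| "run \<alpha> s (CMu p) = (\<lambda>n. rec_nat 0
     (\<lambda>i v. if v = 0 then
        (if run \<alpha> s p (prod_encode (n, i)) = 0 then 1
         else if run \<alpha> s p (prod_encode (n, i)) = 1 then Suc (Suc i) else 0)
      else v) s - 1)"

text \<open>\<open>run\<close> is total, so induction on the program stays within the closure rules
  for total functions. The partial oracle may vary with the input; later it is given by a coded
  list.\<close>

lemma computable_run:
  assumes \<alpha>: "computable_from X (\<lambda>z. \<alpha> (pfst z) (psnd z))"
  shows "computable_from X f \<Longrightarrow> computable_from X g \<Longrightarrow> computable_from X h \<Longrightarrow>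
    computable_from X (\<lambda>x. run (\<alpha> (f x)) (g x) p (h x))"
proof (induction p arbitrary: f g h)
  case COracle
  have "computable_from X (\<lambda>x. (\<lambda>z. \<alpha> (pfst z) (psnd z)) (prod_encode (f x, h x)))"
    by (rule computable_from_comp[OF \<alpha>]) (intro computable_intros COracle)
  then show ?case by simp
next
  case (CPrec p q)
  note c = CPrec.prems computable_from_comp[OF CPrec.prems(1)] computable_from_comp[OF CPrec.prems(2)]
    computable_from_comp[OF CPrec.prems(3)]
  show ?case unfolding run.simps by (intro CPrec.IH computable_intros c)
next
  case (CMu p)
  note c = CMu.prems computable_from_comp[OF CMu.prems(1)] computable_from_comp[OF CMu.prems(2)]
    computable_from_comp[OF CMu.prems(3)]
  show ?case unfolding run.simps by (intro CMu.IH computable_intros c)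
next
  case (CPair p q)
  show ?case unfolding run.simps by (intro CPair.IH computable_intros CPair.prems)
next
  case (CComp p q)
  show ?case unfolding run.simps by (intro CComp.IH computable_intros CComp.prems)
qed (simp; intro computable_intros; assumption)+

text \<open>All answers that \<open>\<alpha>\<close> gives are true of \<open>Y\<close>. A missing
  answer or too small a bound can lead to 0, but not to a wrong output.\<close>

lemma run_sound:
  assumes \<alpha>: "\<And>q. \<alpha> q = 0 \<or> \<alpha> q = Suc (if q \<in> Y then 1 else 0)"
  shows "run \<alpha> s p n = Suc m \<Longrightarrow> computes Y p n m"
proof (induction p arbitrary: n m)
  case CZero
  then show ?case by (auto intro: computes.zero)
next
  case CSucc
  then show ?case by (auto intro: computes.succ)
next
  case CFst
  then show ?case using computes.fst[of Y "pfst n" "psnd n"] by auto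
next
  case CSnd
  then show ?case using computes.snd[of Y "pfst n" "psnd n"] by auto
next
  case COracle
  then show ?case using \<alpha>[of n] computes.query[of Y n] by auto
next
  case (CPair p q)
  then show ?case by (auto split: if_splits intro!: computes.pair simp: gr0_conv_Suc)
next
  case (CComp p q)
  then show ?case by (auto split: if_splits intro!: computes.comp simp: gr0_conv_Suc)
next
  case (CPrec p q)
  have "computes Y (CPrec p q) (prod_encode (pfst n, i)) w"
    if "rec_nat (run \<alpha> s p (pfst n)) (\<lambda>i v. if v = 0 then 0
      else run \<alpha> s q (prod_encode (pfst n, prod_encode (i, v - 1)))) i = Suc w" for i w
    using that
  proof (induction i arbitrary: w)
    case 0
    then show ?case using CPrec.IH(1) by (auto intro: computes.prec_0)
  next
    case (Suc i)
    let ?r = "rec_nat (run \<alpha> s p (pfst n)) (\<lambda>i v. if v = 0 then 0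
      else run \<alpha> s q (prod_encode (pfst n, prod_encode (i, v - 1)))) i"
    obtain v where "?r = Suc v" using Suc.prems by (cases ?r) auto
    then show ?case using Suc CPrec.IH(2) by (auto intro: computes.prec_Suc)
  qed
  from this[of "psnd n" m] show ?case using CPrec.prems by simp
next
  case (CMu p)
  let ?r = "rec_nat 0 (\<lambda>i v. if v = 0 then
        (if run \<alpha> s p (prod_encode (n, i)) = 0 then 1
         else if run \<alpha> s p (prod_encode (n, i)) = 1 then Suc (Suc i) else 0)
      else v)"
  \<comment> \<open>State 0 after \<open>t\<close> rounds means that all values before
    \<open>t\<close> are defined and nonzero, as \<open>computes.mu\<close> demands.\<close>
  have 0: "?r t = 0 \<Longrightarrow> \<forall>i<t. \<exists>v. run \<alpha> s p (prod_encode (n, i)) = Suc (Suc v)" for t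
  proof (induction t)
    case (Suc t)
    then show ?case
      by (cases "run \<alpha> s p (prod_encode (n, t))") (auto split: if_splits simp: less_Suc_eq gr0_conv_Suc)
  qed simp
  \<comment> \<open>This state can be entered only in round \<open>m\<close>, from state 0.\<close>
  have "?r t = Suc (Suc m) \<Longrightarrow> run \<alpha> s p (prod_encode (n, m)) = 1 \<and> ?r m = 0" for t
    by (induction t) (auto split: if_splits)
  moreover have "?r s = Suc (Suc m)" using CMu.prems by simp
  ultimately have "run \<alpha> s p (prod_encode (n, m)) = 1" "?r m = 0" by blast+
  with 0[of m] CMu.IH show ?case by (auto intro!: computes.mu) blast
qed

definition answers :: "nat set \<Rightarrow> nat set \<Rightarrow> (nat \<Rightarrow> nat) \<Rightarrow> bool" where
  "answers Y F \<alpha> \<longleftrightarrow> (\<forall>q\<in>F. \<alpha> q = Suc (if q \<in> Y then 1 else 0))"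

lemma answers_Un: "answers Y (F \<union> G) \<alpha> \<longleftrightarrow> answers Y F \<alpha> \<and> answers Y G \<alpha>"
  by (auto simp: answers_def)

lemma answers_subset: "answers Y F \<alpha> \<Longrightarrow> G \<subseteq> F \<Longrightarrow> answers Y G \<alpha>"
  unfolding answers_def by blast

text \<open>\<open>F\<close> is the use of the computation.\<close>

lemma run_complete:
  assumes "computes Y p n m"
  shows "\<exists>F t. finite F \<and> (\<forall>\<alpha> s. t \<le> s \<longrightarrow> answers Y F \<alpha> \<longrightarrow> run \<alpha> s p n = Suc m)"
  using assms
proof (induction rule: computes.induct)
  case (query n)
  show ?case by (rule exI[of _ "{n}"]) (auto simp: answers_def)
next
  case (pair p n a q b)
  obtain F t where "finite F"
    "\<And>\<alpha> s. t \<le> s \<Longrightarrow> answers Y F \<alpha> \<Longrightarrow> run \<alpha> s p n = Suc a"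
    using pair.IH(1) by blast
  moreover obtain G u where "finite G"
    "\<And>\<alpha> s. u \<le> s \<Longrightarrow> answers Y G \<alpha> \<Longrightarrow> run \<alpha> s q n = Suc b"
    using pair.IH(2) by blast
  ultimately show ?case
    by (intro exI[of _ "F \<union> G"] exI[of _ "max t u"]) (simp add: answers_Un)
next
  case (comp q n k p m)
  obtain F t where "finite F"
    "\<And>\<alpha> s. t \<le> s \<Longrightarrow> answers Y F \<alpha> \<Longrightarrow> run \<alpha> s q n = Suc k"
    using comp.IH(1) by blast
  moreover obtain G u where "finite G"
    "\<And>\<alpha> s. u \<le> s \<Longrightarrow> answers Y G \<alpha> \<Longrightarrow> run \<alpha> s p k = Suc m"
    using comp.IH(2) by blast
  ultimately show ?case
    by (intro exI[of _ "F \<union> G"] exI[of _ "max t u"]) (simp add: answers_Un)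
next
  case (prec_0 p a v q)
  then show ?case by simp
next
  case (prec_Suc p q a n v w)
  obtain F t where "finite F"
    "\<And>\<alpha> s. t \<le> s \<Longrightarrow> answers Y F \<alpha> \<Longrightarrow> run \<alpha> s (CPrec p q) (prod_encode (a, n)) = Suc v"
    using prec_Suc.IH(1) by blast
  moreover obtain G u where "finite G"
    "\<And>\<alpha> s. u \<le> s \<Longrightarrow> answers Y G \<alpha> \<Longrightarrow>
      run \<alpha> s q (prod_encode (a, prod_encode (n, v))) = Suc w"
    using prec_Suc.IH(2) by blast
  moreover have "run \<alpha> s (CPrec p q) (prod_encode (a, Suc n)) = Suc w"
    if "run \<alpha> s (CPrec p q) (prod_encode (a, n)) = Suc v"
      "run \<alpha> s q (prod_encode (a, prod_encode (n, v))) = Suc w" for \<alpha> s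
    using that unfolding run.simps prod_encode_inverse fst_conv snd_conv by simp
  ultimately show ?case
    by (intro exI[of _ "F \<union> G"] exI[of _ "max t u"]) (simp add: answers_Un del: run.simps)
next
  case (mu p a m)
  have "\<exists>v F t. finite F \<and> (\<forall>\<alpha> s. t \<le> s \<longrightarrow> answers Y F \<alpha> \<longrightarrow>
      run \<alpha> s p (prod_encode (a, i)) = Suc (Suc v))" if "i < m" for i
    using mu.IH(2)[OF that] by blast
  then obtain v F t where i: "\<And>i. i < m \<Longrightarrow> finite (F i)"
    "\<And>i \<alpha> s. i < m \<Longrightarrow> t i \<le> s \<Longrightarrow> answers Y (F i) \<alpha> \<Longrightarrow>
      run \<alpha> s p (prod_encode (a, i)) = Suc (Suc (v i))"
    by metis
  obtain G u where m: "finite G"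
    "\<And>\<alpha> s. u \<le> s \<Longrightarrow> answers Y G \<alpha> \<Longrightarrow> run \<alpha> s p (prod_encode (a, m)) = Suc 0"
    using mu.IH(1) by blast
  \<comment> \<open>Bounds all the subcomputations; \<open>Suc m\<close> rounds are needed for the
    search to reach \<open>m\<close>.\<close>
  define T where "T = Max (insert (Suc m) (insert u (t ` {..<m})))"
  have T: "Suc m \<le> T" "u \<le> T" "\<And>i. i < m \<Longrightarrow> t i \<le> T"
    unfolding T_def by (auto intro!: Max_ge simp del: Max_insert)
  have "run \<alpha> s (CMu p) a = Suc m" if s: "T \<le> s" and A: "answers Y (G \<union> (\<Union>i<m. F i)) \<alpha>" for \<alpha> s
  proof -
    let ?r = "rec_nat 0 (\<lambda>i v. if v = 0 then
          (if run \<alpha> s p (prod_encode (a, i)) = 0 then 1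
           else if run \<alpha> s p (prod_encode (a, i)) = 1 then Suc (Suc i) else 0)
        else v)"
    have less: "run \<alpha> s p (prod_encode (a, i)) = Suc (Suc (v i))" if "i < m" for i
    proof (rule i(2)[OF that])
      show "t i \<le> s" using T(3)[OF that] s by simp
      show "answers Y (F i) \<alpha>" by (rule answers_subset[OF A]) (use that in auto)
    qed
    have "j \<le> m \<Longrightarrow> ?r j = 0" for j
      by (induction j) (auto simp: less)
    moreover have "run \<alpha> s p (prod_encode (a, m)) = Suc 0"
      using m(2)[of s \<alpha>] T(2) s A by (simp add: answers_Un)
    ultimately have "?r (Suc m) = Suc (Suc m)" by simp
    then have "?r (Suc m + d) = Suc (Suc m)" for d
      by (induction d) auto
    then have "?r s = Suc (Suc m)" using le_Suc_ex[of "Suc m" s] T(1) s by auto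
    then show ?thesis by simp
  qed
  then show ?case using i(1) m(1)
    by (intro exI[of _ "G \<union> (\<Union>i<m. F i)"] exI[of _ T]) (simp del: run.simps)
qed auto

text \<open>Halting is success of \<open>run\<close> for some bound. The constant 1 answers "no" to
  every query, so it is the empty oracle, fully known.\<close>

lemma ce_set_semidecidable:
  assumes "ce_set W"
  shows "semidecidable_from X (\<lambda>n. n \<in> W)"
proof -
  obtain p where W: "W = {n. \<exists>m. computes {} p n m}" using assms unfolding ce_set_def by blast
  have "semidecidable_from {} (\<lambda>n. n \<in> W)"
  proof (rule semidecidableI[where R = "\<lambda>n s. run (\<lambda>_. 1) s p n \<noteq> 0"])
    show "decidable_from {} (\<lambda>z. run (\<lambda>_. 1) (psnd z) p (pfst z) \<noteq> 0)"
      by (intro computable_intros computable_run[where \<alpha> = "\<lambda>_ _. 1" and f = "\<lambda>_. 0"])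
    show "n \<in> W \<longleftrightarrow> (\<exists>s. run (\<lambda>_. 1) s p n \<noteq> 0)" for n
    proof
      assume "n \<in> W"
      then obtain m where "computes {} p n m" unfolding W by blast
      from run_complete[OF this] obtain s where "run (\<lambda>_. 1) s p n = Suc m"
        by (fastforce simp: answers_def)
      then show "\<exists>s. run (\<lambda>_. 1) s p n \<noteq> 0" by (intro exI[of _ s]) simp
    next
      assume "\<exists>s. run (\<lambda>_. 1) s p n \<noteq> 0"
      then obtain s m where "run (\<lambda>_. 1) s p n = Suc m" using not0_implies_Suc by blast
      with run_sound[of "\<lambda>_. 1" "{}" s p n m] show "n \<in> W" unfolding W by auto
    qed
  qed
  then show ?thesis by (rule semidecidable_from_mono)
qed

primrec program_code :: "program \<Rightarrow> nat" where
  "program_code CZero = prod_encode (0, 0)"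
| "program_code CSucc = prod_encode (1, 0)"
| "program_code CFst = prod_encode (2, 0)"
| "program_code CSnd = prod_encode (3, 0)"
| "program_code COracle = prod_encode (4, 0)"
| "program_code (CPair p q) = prod_encode (5, prod_encode (program_code p, program_code q))"
| "program_code (CComp p q) = prod_encode (6, prod_encode (program_code p, program_code q))"
| "program_code (CPrec p q) = prod_encode (7, prod_encode (program_code p, program_code q))"
| "program_code (CMu p) = prod_encode (8, program_code p)"

text \<open>Lets the generic construction run through all programs as
  \<open>inv program_code e\<close>.\<close>

lemma inj_program_code: "inj program_code"
proof (rule injI)
  show "program_code p = program_code q \<Longrightarrow> p = q" for p q
    by (induction p arbitrary: q; case_tac q) auto
qed

section \<open>Separating products of sets\<close>

text \<open>Tuples are right-nested pairs whose tail is ignored, so every number codes a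
  \<open>k\<close>-tuple for every \<open>k\<close>.\<close>

primrec coord :: "nat \<Rightarrow> nat \<Rightarrow> nat" where
  "coord 0 t = pfst t"
| "coord (Suc i) t = coord i (psnd t)"

lemma computable_coord [computable_intros]:
  "computable_from X f \<Longrightarrow> computable_from X (\<lambda>x. coord i (f x))"
  by (induction i arbitrary: f) (auto intro: computable_intros)

text \<open>
  If some section of \<open>V\<close> at \<open>n \<notin> W\<^sub>0\<close> still separates, then the first coordinate can be dropped;
  otherwise \<open>V\<close> enumerates the complement of \<open>W\<^sub>0\<close>.
\<close>

lemma decidable_factor_if_separated:
  fixes W :: "nat \<Rightarrow> nat \<Rightarrow> bool"
  assumes "semidecidable_from X V"
    and "\<And>i. i < k \<Longrightarrow> semidecidable_from X (W i)"
    and "\<And>t. (\<And>i. i < k \<Longrightarrow> \<not> W i (coord i t)) \<Longrightarrow> V t"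
    and "\<And>t. V t \<Longrightarrow> \<exists>i<k. \<not> W i (coord i t)"
  shows "\<exists>i<k. decidable_from X (W i)"
  using assms
proof (induction k arbitrary: V W)
  case 0
  \<comment> \<open>Without coordinates the two conditions on \<open>V\<close> contradict each
    other.\<close>
  then show ?case by auto
next
  case (Suc k)
  let ?S = "\<lambda>n t. V (prod_encode (n, t))"
  have S: "semidecidable_from X (?S n)" for n
    by (rule semidecidable_comp[OF Suc.prems(1)]) (intro computable_intros)
  show ?case
  proof (cases "\<exists>n. \<not> W 0 n \<and> (\<forall>t. ?S n t \<longrightarrow> (\<exists>i<k. \<not> W (Suc i) (coord i t)))")
    case True
    then obtain n where n: "\<not> W 0 n" "\<And>t. ?S n t \<Longrightarrow> \<exists>i<k. \<not> W (Suc i) (coord i t)" by blast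
    have "\<exists>i<k. decidable_from X (W (Suc i))"
    proof (rule Suc.IH[where V = "?S n"])
      show "semidecidable_from X (?S n)" by (rule S)
      show "\<exists>i<k. \<not> W (Suc i) (coord i t)" if "?S n t" for t using n(2) that .
      show "semidecidable_from X (W (Suc i))" if "i < k" for i using Suc.prems(2) that by simp
      show "?S n t" if "\<And>i. i < k \<Longrightarrow> \<not> W (Suc i) (coord i t)" for t
      proof (rule Suc.prems(3))
        show "\<not> W i (coord i (prod_encode (n, t)))" if "i < Suc k" for i
          using that \<open>\<And>i. i < k \<Longrightarrow> \<not> W (Suc i) (coord i t)\<close> n(1) by (cases i) auto
      qed
    qed
    then show ?thesis by auto
  next
    case False
    \<comment> \<open>All later coordinates of \<open>t\<close> lie inside their sets, so only the
      first can be the one outside.\<close>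
    have "\<not> W 0 n \<longleftrightarrow> (\<exists>t. ?S n t \<and> (\<forall>i<k. W (Suc i) (coord i t)))" for n
    proof
      assume "\<exists>t. ?S n t \<and> (\<forall>i<k. W (Suc i) (coord i t))"
      then obtain t where t: "?S n t" "\<forall>i<k. W (Suc i) (coord i t)" by blast
      from Suc.prems(4)[OF t(1)] obtain i where "i < Suc k" "\<not> W i (coord i (prod_encode (n, t)))"
        by blast
      with t(2) show "\<not> W 0 n" by (cases i) auto
    qed (use False in blast)
    moreover have "semidecidable_from X (\<lambda>n. \<exists>t. ?S n t \<and> (\<forall>i<k. W (Suc i) (coord i t)))"
    proof (intro semidecidable_ex semidecidable_conj semidecidable_all_less)
      show "semidecidable_from X (\<lambda>z. ?S (pfst z) (psnd z))" using Suc.prems(1) by simp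
      show "semidecidable_from X (\<lambda>z. W (Suc i) (coord i (psnd z)))" if "i < k" for i
        using that by (intro semidecidable_comp[OF Suc.prems(2)] computable_intros) auto
    qed
    ultimately have "semidecidable_from X (\<lambda>n. \<not> W 0 n)" by presburger
    with Suc.prems(2)[of 0] have "decidable_from X (W 0)" by (intro Post) auto
    then show ?thesis by blast
  qed
qed

section \<open>Structures with binary relations only\<close>

definition binary_language :: language where
  "binary_language = \<lparr>rel_arity = \<lambda>_. Some 2, fun_arity = \<lambda>_. None\<rparr>"

text \<open>All relations in one set, uniformly in the symbol; it is Turing equivalent to the atomic
  diagram by the two reductions below.\<close>

definition rel_graph :: "struc \<Rightarrow> nat set" where
  "rel_graph B = {z. rel_interp B (pfst z) [pfst (psnd z), psnd (psnd z)]}"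

lemma computable_binary_language: "computable_language binary_language"
proof -
  have "\<exists>p. \<forall>s n. 2 = n \<longrightarrow> computes {} p s n"
    using computable_const[of "{}" 2] unfolding computable_from_def by auto
  then show ?thesis
    by (simp add: computable_language_def computable_arity_def binary_language_def
        turing_le_iff_decidable decidable_const)
qed

lemma wf_literal_binary_language:
  assumes "wf_literal binary_language \<phi>"
  obtains a b where "\<phi> = Pos (Equal (Elem a) (Elem b)) \<or> \<phi> = Neg (Equal (Elem a) (Elem b))"
  | r a b where "\<phi> = Pos (Rel r [Elem a, Elem b]) \<or> \<phi> = Neg (Rel r [Elem a, Elem b])"
proof -
  have t: "\<exists>a. t = Elem a" if "wf_cterm binary_language t" for t
    using that by (cases t) (auto simp: binary_language_def)
  have "(\<exists>a b. \<psi> = Equal (Elem a) (Elem b)) \<or> (\<exists>r a b. \<psi> = Rel r [Elem a, Elem b])"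
    if "wf_atomic binary_language \<psi>" for \<psi>
  proof (cases \<psi>)
    case (Equal s u)
    then show ?thesis using that t[of s] t[of u] by auto
  next
    case (Rel r ts)
    then have "length ts = 2" "list_all (wf_cterm binary_language) ts"
      using that by (auto simp: binary_language_def)
    then obtain s u where "ts = [s, u]" "wf_cterm binary_language s" "wf_cterm binary_language u"
      by (auto simp: numeral_2_eq_2 length_Suc_conv)
    then show ?thesis using Rel t[of s] t[of u] by auto
  qed
  then show thesis using assms that by (cases \<phi>) (simp_all, blast+)
qed

text \<open>A number is decoded as if it were a literal and encoded again; it has the right shape
  exactly if this returns the number itself.\<close>

lemma atomic_diagram_le_rel_graph:
  "turing_le (atomic_diagram binary_language B) (rel_graph B)"
proof -
  let ?s = "\<lambda>q. psnd (pfst (psnd (psnd q)))" and ?t = "\<lambda>q. psnd (psnd (psnd (psnd q)))"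
  let ?r = "\<lambda>q. pfst (psnd (psnd q))"
  \<comment> \<open>\<open>list_encode\<close> sends a nonempty list to a successor, hence the
    subtraction of 1.\<close>
  let ?l = "\<lambda>q. psnd (psnd (psnd q)) - 1"
  let ?a = "\<lambda>q. psnd (pfst (?l q))" and ?b = "\<lambda>q. psnd (pfst (psnd (?l q) - 1))"
  let ?E = "\<lambda>q. prod_encode (0, prod_encode (prod_encode (0, ?s q), prod_encode (0, ?t q)))"
  let ?R = "\<lambda>q. prod_encode (1, prod_encode (?r q,
    Suc (prod_encode (prod_encode (0, ?a q), Suc (prod_encode (prod_encode (0, ?b q), 0))))))"
  let ?P = "\<lambda>q. (q = prod_encode (0, ?E q) \<and> ?s q = ?t q) \<or> (q = prod_encode (1, ?E q) \<and> ?s q \<noteq> ?t q) \<or>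
    (q = prod_encode (0, ?R q) \<and> prod_encode (?r q, prod_encode (?a q, ?b q)) \<in> rel_graph B) \<or>
    (q = prod_encode (1, ?R q) \<and> prod_encode (?r q, prod_encode (?a q, ?b q)) \<notin> rel_graph B)"
  have "q \<in> atomic_diagram binary_language B \<longleftrightarrow> ?P q" for q
  proof
    assume "q \<in> atomic_diagram binary_language B"
    then obtain \<phi> where "q = literal_code \<phi>" "wf_literal binary_language \<phi>" "holds_literal B \<phi>"
      unfolding atomic_diagram_def by blast
    then show "?P q" by (elim wf_literal_binary_language) (auto simp: rel_graph_def)
  next
    have *: "literal_code \<phi> \<in> atomic_diagram binary_language B"
      if "wf_literal binary_language \<phi>" "holds_literal B \<phi>" for \<phi>
      using that unfolding atomic_diagram_def by blast
    assume "?P q"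
    then show "q \<in> atomic_diagram binary_language B"
      using *[of "Pos (Equal (Elem (?s q)) (Elem (?t q)))"]
        *[of "Neg (Equal (Elem (?s q)) (Elem (?t q)))"]
        *[of "Pos (Rel (?r q) [Elem (?a q), Elem (?b q)])"]
        *[of "Neg (Rel (?r q) [Elem (?a q), Elem (?b q)])"]
      by (elim disjE conjE) (simp_all add: binary_language_def rel_graph_def)
  qed
  moreover have "decidable_from (rel_graph B) ?P"
    by (intro computable_intros
        decidable_comp[OF turing_le_refl[unfolded turing_le_iff_decidable, of "rel_graph B"]])
  ultimately show ?thesis unfolding turing_le_iff_decidable by presburger
qed

lemma rel_graph_le_atomic_diagram:
  "turing_le (rel_graph B) (atomic_diagram binary_language B)"
proof -
  let ?c = "\<lambda>z. prod_encode (0, prod_encode (1, prod_encode (pfst z,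
    Suc (prod_encode (prod_encode (0, pfst (psnd z)), Suc (prod_encode (prod_encode (0, psnd (psnd z)), 0)))))))"
  have "z \<in> rel_graph B \<longleftrightarrow> ?c z \<in> atomic_diagram binary_language B" for z
  proof -
    let ?\<phi> = "Pos (Rel (pfst z) [Elem (pfst (psnd z)), Elem (psnd (psnd z))])"
    have "?c z = literal_code ?\<phi>" by simp
    moreover have "literal_code ?\<phi> \<in> atomic_diagram binary_language B \<longleftrightarrow>
        wf_literal binary_language ?\<phi> \<and> holds_literal B ?\<phi>"
      unfolding atomic_diagram_def image_iff literal_code_inject by blast
    ultimately show ?thesis by (simp add: rel_graph_def binary_language_def)
  qed
  moreover have "decidable_from (atomic_diagram binary_language B)
      (\<lambda>z. ?c z \<in> atomic_diagram binary_language B)"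
    by (intro computable_intros
        decidable_comp[OF turing_le_refl[unfolded turing_le_iff_decidable]])
  ultimately show ?thesis unfolding turing_le_iff_decidable by presburger
qed

section \<open>The structure\<close>

text \<open>
  Component \<open>n\<close> consists of two base elements of the same kind, the root \<open>(0, n)\<close> and the twin
  \<open>(1, n)\<close>, and of witnesses attached to them. The root has for every \<open>i < k\<close> a witness of kind
  \<open>(1, n, i)\<close>; when \<open>i\<close> fires at \<open>n\<close>, the twin receives such a witness as well and the root
  receives one of kind \<open>(2, n, i)\<close>. So knowing whether \<open>i\<close> fires at \<open>n\<close>, for a single \<open>i\<close>, suffices
  to tell the root from the twin. All the remaining numbers are padding, each of its own kind.
  Relation \<open>r\<close> holds of \<open>a, b\<close> if \<open>a\<close> has kind \<open>r\<close> and is attached to \<open>b\<close>.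
\<close>

locale firing =
  fixes k :: nat and live :: "nat \<Rightarrow> nat \<Rightarrow> bool"
  assumes k_pos: "0 < k"
    and live_decidable: "decidable_from {} (\<lambda>z. live (pfst z) (psnd z))"
    and live_unique: "live m s \<Longrightarrow> live m s' \<Longrightarrow> s = s'"
    and live_less: "live m s \<Longrightarrow> psnd m < k"
begin

text \<open>\<open>live\<close> names the stage at which an event is discovered. It is decidable,
  whereas firing is only c.e.\<close>

definition fires :: "nat \<Rightarrow> nat \<Rightarrow> bool" where
  "fires n i \<longleftrightarrow> (\<exists>s. live (prod_encode (n, i)) s)"

text \<open>The first component of an element is a tag: 0 and 1 for root and twin, 2 for original
  witnesses, 3 and 4 for those added on firing. The latter carry their stage, which keeps
  \<open>kind\<close> computable.\<close>

definition kind :: "nat \<Rightarrow> nat" where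
  "kind e =
    (if pfst e \<le> 1 then prod_encode (0, psnd e)
     else if pfst e = 2 \<and> psnd (psnd e) < k then prod_encode (1, psnd e)
     else if pfst e = 3 \<and> live (pfst (psnd e)) (psnd (psnd e)) then prod_encode (1, pfst (psnd e))
     else if pfst e = 4 \<and> live (pfst (psnd e)) (psnd (psnd e)) then prod_encode (2, pfst (psnd e))
     else prod_encode (3, e))"

text \<open>Base elements own themselves. The padding is gathered at component 0, which the swapping
  argument avoids.\<close>

definition owner :: "nat \<Rightarrow> nat" where
  "owner e =
    (if pfst e \<le> 1 then e
     else if pfst e = 2 \<and> psnd (psnd e) < k then prod_encode (0, pfst (psnd e))
     else if pfst e = 3 \<and> live (pfst (psnd e)) (psnd (psnd e)) then prod_encode (1, pfst (pfst (psnd e)))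
     else if pfst e = 4 \<and> live (pfst (psnd e)) (psnd (psnd e)) then prod_encode (0, pfst (pfst (psnd e)))
     else prod_encode (0, 0))"

abbreviation root :: "nat \<Rightarrow> nat" where "root n \<equiv> prod_encode (0, n)"
abbreviation twin :: "nat \<Rightarrow> nat" where "twin n \<equiv> prod_encode (Suc 0, n)"

lemma element_cases:
  obtains (root) n where "e = root n" "kind e = prod_encode (0, n)" "owner e = e"
  | (twin) n where "e = twin n" "kind e = prod_encode (0, n)" "owner e = e"
  | (old) n i where "e = prod_encode (2, prod_encode (n, i))" "i < k"
      "kind e = prod_encode (1, prod_encode (n, i))" "owner e = root n"
  | (copied) n i s where "e = prod_encode (3, prod_encode (prod_encode (n, i), s))"
      "live (prod_encode (n, i)) s"
      "kind e = prod_encode (1, prod_encode (n, i))" "owner e = twin n"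
  | (new) n i s where "e = prod_encode (4, prod_encode (prod_encode (n, i), s))"
      "live (prod_encode (n, i)) s"
      "kind e = prod_encode (2, prod_encode (n, i))" "owner e = root n"
  | (padding) "kind e = prod_encode (3, e)" "owner e = root 0"
proof -
  obtain t r where e: "e = prod_encode (t, r)" by (metis prod_decode_inverse surj_pair)
  obtain m s where r: "r = prod_encode (m, s)" by (metis prod_decode_inverse surj_pair)
  obtain n i where m: "m = prod_encode (n, i)" by (metis prod_decode_inverse surj_pair)
  consider "t = 0" | "t = 1" | "t = 2 \<and> s < k" | "t = 3 \<and> live m s" | "t = 4 \<and> live m s"
    | "1 < t" "\<not> (t = 2 \<and> s < k)" "\<not> (t = 3 \<and> live m s)" "\<not> (t = 4 \<and> live m s)"
    by linarith
  then show thesis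
  proof cases
    case 1
    then show ?thesis by (intro that(1)[of r]) (auto simp: e kind_def owner_def)
  next
    case 2
    then show ?thesis by (intro that(2)[of r]) (auto simp: e kind_def owner_def)
  next
    case 3
    then show ?thesis by (intro that(3)[of m s]) (auto simp: e r kind_def owner_def)
  next
    case 4
    then show ?thesis by (intro that(4)[of n i s]) (auto simp: e r m kind_def owner_def)
  next
    case 5
    then show ?thesis by (intro that(5)[of n i s]) (auto simp: e r m kind_def owner_def)
  next
    case 6
    then show ?thesis by (intro that(6)) (auto simp: e r kind_def owner_def)
  qed
qed

lemma root_simps [simp]:
  "kind (root n) = prod_encode (0, n)" "owner (root n) = root n"
  "kind (twin n) = prod_encode (0, n)" "owner (twin n) = twin n"
  by (simp_all add: kind_def owner_def)

lemma old_simps [simp]: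
  assumes "i < k"
  shows "kind (prod_encode (2, prod_encode (n, i))) = prod_encode (1, prod_encode (n, i))"
    "owner (prod_encode (2, prod_encode (n, i))) = root n"
  using assms by (simp_all add: kind_def owner_def)

lemma live_simps:
  assumes "live (prod_encode (n, i)) s"
  shows "kind (prod_encode (3, prod_encode (prod_encode (n, i), s))) = prod_encode (1, prod_encode (n, i))"
    "owner (prod_encode (3, prod_encode (prod_encode (n, i), s))) = twin n"
    "kind (prod_encode (4, prod_encode (prod_encode (n, i), s))) = prod_encode (2, prod_encode (n, i))"
    "owner (prod_encode (4, prod_encode (prod_encode (n, i), s))) = root n"
  using assms by (simp_all add: kind_def owner_def)

text \<open>The element can be reconstructed by \<open>d\<close>: the kind gives the indices, the
  owner separates root from twin, and \<open>live_unique\<close> recovers the stage.\<close>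

lemma element_unique:
  assumes "kind a = kind b" "owner a = owner b"
  shows "a = b"
proof -
  define d where "d x w = (if pfst x = 0 then w
    else if pfst x = 1 then
      (if pfst w = 0 then prod_encode (2, psnd x) else prod_encode (3, prod_encode (psnd x, The (live (psnd x)))))
    else if pfst x = 2 then prod_encode (4, prod_encode (psnd x, The (live (psnd x))))
    else psnd x)" for x w
  have "d (kind e) (owner e) = e" for e
  proof -
    have the: "The (live m) = s" if "live m s" for m s
      using that live_unique by (intro the_equality)
    show ?thesis by (cases e rule: element_cases) (simp_all add: d_def the)
  qed
  with assms show ?thesis by metis
qed

lemma kind_base: "kind e = prod_encode (0, n) \<longleftrightarrow> e = root n \<or> e = twin n"
  by (cases e rule: element_cases) auto

lemma owner_base: "owner e = root n \<or> owner e = twin n" if "n = psnd (owner e)"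
  using that by (cases e rule: element_cases) auto

lemma owner_owner [simp]: "owner (owner e) = owner e"
  using owner_base[OF refl, of e] by (metis root_simps(2,4))

lemma kind_owner: "kind (owner e) = prod_encode (0, psnd (owner e))"
  using owner_base[OF refl, of e] by (metis root_simps(1,3))

text \<open>A kind of witness that occurs at the root but not at the twin; naming it takes the truth
  value of \<open>fires n i\<close>.\<close>

definition mark :: "nat \<Rightarrow> nat \<Rightarrow> nat" where
  "mark n i = prod_encode (if fires n i then 2 else 1, prod_encode (n, i))"

lemma mark_attached:
  assumes "i < k"
  shows "\<exists>e. kind e = mark n i"
proof (cases "fires n i")
  case True
  then obtain s where "live (prod_encode (n, i)) s" unfolding fires_def by blast
  with True show ?thesis using live_simps(3) by (auto simp: mark_def)
next
  case False
  with old_simps(1)[OF assms] show ?thesis by (auto simp: mark_def)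
qed

text \<open>The twin has a witness of kind \<open>(1, n, i)\<close> only if \<open>i\<close> fires,
  and then the mark is \<open>(2, n, i)\<close>.\<close>

lemma owner_mark:
  assumes "kind e = mark n i"
  shows "owner e = root n"
proof (cases e rule: element_cases)
  case (copied m j s)
  then have "fires m j" unfolding fires_def by blast
  with assms copied(3) show ?thesis by (simp add: mark_def split: if_splits)
qed (use assms in \<open>simp_all add: mark_def split: if_splits\<close>)

section \<open>Computability, copies and rigidity of the structure\<close>

lemma computable_kind [computable_intros]:
  "computable_from X f \<Longrightarrow> computable_from X (\<lambda>x. kind (f x))"
  unfolding kind_def
  by (intro computable_intros decidable_comp2[OF decidable_from_mono[OF live_decidable]])

lemma computable_owner [computable_intros]:
  "computable_from X f \<Longrightarrow> computable_from X (\<lambda>x. owner (f x))"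
  unfolding owner_def
  by (intro computable_intros decidable_comp2[OF decidable_from_mono[OF live_decidable]])

text \<open>The pullback along \<open>\<pi>\<close>, which thereby becomes the isomorphism onto
  \<open>copy id\<close>, the structure of the theorem.\<close>

definition copy :: "(nat \<Rightarrow> nat) \<Rightarrow> struc" where
  "copy \<pi> = \<lparr>rel_interp = \<lambda>r xs. kind (\<pi> (xs ! 0)) = r \<and> owner (\<pi> (xs ! 0)) = \<pi> (xs ! 1),
    fun_interp = \<lambda>_ _. 0\<rparr>"

lemma isomorphism_copy: "bij \<pi> \<Longrightarrow> is_isomorphism binary_language (copy \<pi>) (copy id) \<pi>"
  by (auto simp: is_isomorphism_def binary_language_def copy_def)

lemma isomorphism_rel:
  assumes "is_isomorphism binary_language B (copy id) h"
  shows "rel_interp B r [a, b] \<longleftrightarrow> kind (h a) = r \<and> owner (h a) = h b"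
proof -
  have "rel_interp B r [a, b] \<longleftrightarrow> rel_interp (copy id) r (map h [a, b])"
    using assms unfolding is_isomorphism_def by (auto simp: binary_language_def)
  then show ?thesis by (simp add: copy_def)
qed

lemma computable_structure_copy_id: "computable_structure binary_language (copy id)"
proof -
  have "decidable_from {} (\<lambda>z. kind (pfst (psnd z)) = pfst z \<and> owner (pfst (psnd z)) = psnd (psnd z))"
    by (intro computable_intros)
  then have "turing_le (rel_graph (copy id)) {}"
    by (simp add: turing_le_iff_decidable rel_graph_def copy_def)
  with turing_le_trans[OF atomic_diagram_le_rel_graph]
  show ?thesis by (simp add: computable_structure_def computable_binary_language)
qed

text \<open>Both maps respect kinds and attachment. Elements of kind \<open>mark n 0\<close>
  identify the root, the twin is the other base element, and kind and owner determine the
  rest.\<close>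

lemma isomorphism_unique:
  assumes h: "is_isomorphism binary_language B (copy id) h"
    and g: "is_isomorphism binary_language B (copy id) g"
  shows "h = g"
proof
  have bij: "bij h" "inj g" using h g unfolding is_isomorphism_def by (auto intro: bij_is_inj)
  have eq: "kind (g a) = kind (h a) \<and> owner (g a) = g b" if "owner (h a) = h b" for a b
  proof -
    have "rel_interp B (kind (h a)) [a, b]" using that unfolding isomorphism_rel[OF h] by (rule conjI[OF refl])
    then show ?thesis unfolding isomorphism_rel[OF g] .
  qed
  have surj: "\<exists>a. h a = x" for x
    using surjD[OF bij_is_surj[OF bij(1)], of x] by (auto intro: sym)
  have kind: "kind (g a) = kind (h a)" for a
  proof -
    obtain b where "h b = owner (h a)" using surj by blast
    then show ?thesis using eq[of a b] by simp
  qed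
  have root: "g c = root n" if c: "h c = root n" for c n
  proof -
    obtain e where e: "kind e = mark n 0" using mark_attached[OF k_pos] by blast
    obtain a where "h a = e" using surj by blast
    with e have a: "kind (h a) = mark n 0" by simp
    have "owner (h a) = h c" using owner_mark[OF a] c by simp
    then have "kind (g a) = mark n 0" "owner (g a) = g c" using eq[of a c] a by auto
    then show ?thesis using owner_mark[of "g a" n 0] by simp
  qed
  have twin: "g c = twin n" if c: "h c = twin n" for c n
  proof -
    obtain d where d: "h d = root n" using surj by blast
    then have "c \<noteq> d" using c by auto
    then have "g c \<noteq> root n" using root[OF d] injD[OF bij(2), of c d] by auto
    moreover have "kind (g c) = prod_encode (0, n)" using kind[of c] c by simp
    ultimately show ?thesis by (simp add: kind_base)
  qed
  fix a
  obtain b where b: "h b = owner (h a)" using surj by blast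
  have "owner (g a) = g b" using eq[OF b[symmetric]] by (rule conjunct2)
  also have "g b = h b"
    using owner_base[OF refl, of "h a"] root[of b] twin[of b] b by fastforce
  also note b
  finally have "owner (g a) = owner (h a)" .
  from element_unique[OF kind[of a] this] show "h a = g a" by (rule sym)
qed

lemma rigid_copy_id: "rigid_structure binary_language (copy id)"
  unfolding rigid_structure_def
  by (intro allI impI) (rule isomorphism_unique[OF _ isomorphism_copy[OF bij_id]])

text \<open>Kinds and owners can be read off \<open>B\<close>. One decided index \<open>i\<close>
  gives the mark to search for, hence the root of each component.\<close>

lemma computable_isomorphism:
  assumes h: "is_isomorphism binary_language B (copy id) h"
    and i: "i < k" "decidable_from Y (\<lambda>n. fires n i)"
    and B: "turing_le (rel_graph B) Y"
  shows "computable_from Y h"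
proof -
  have bij: "bij h" using h unfolding is_isomorphism_def by auto
  have surj: "\<exists>a. h a = x" for x using bij by (metis bij_pointE)
  have h_eq: "h a = h b \<longleftrightarrow> a = b" for a b using bij by (metis bij_is_inj injD)
  \<comment> \<open>Exactly one symbol relates \<open>a\<close> to exactly one element, so the
    search finds the kind of \<open>a\<close> and the name in \<open>B\<close> of its owner.\<close>
  define f where "f a = (LEAST z. rel_interp B (pfst z) [a, psnd z])" for a
  have ex: "\<exists>z. rel_interp B (pfst z) [a, psnd z]" for a
  proof -
    obtain b where "h b = owner (h a)" using surj by blast
    then show ?thesis
      by (intro exI[of _ "prod_encode (kind (h a), b)"]) (simp add: isomorphism_rel[OF h])
  qed
  have "decidable_from Y (\<lambda>z. prod_encode (pfst (psnd z), prod_encode (pfst z, psnd (psnd z))) \<in> rel_graph B)"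
    by (rule decidable_comp[OF B[unfolded turing_le_iff_decidable]]) (intro computable_intros)
  then have "decidable_from Y (\<lambda>z. rel_interp B (pfst (psnd z)) [pfst z, psnd (psnd z)])"
    by (simp add: rel_graph_def)
  then have comp_f: "computable_from Y f"
    unfolding f_def by (rule computable_Least) (rule ex)
  have f: "pfst (f a) = kind (h a)" "h (psnd (f a)) = owner (h a)" for a
    using LeastI_ex[OF ex[of a], folded f_def] by (auto simp: isomorphism_rel[OF h])
  \<comment> \<open>The name in \<open>B\<close> of the root of component \<open>n\<close>; here the
    truth value of \<open>fires n i\<close> enters, through \<open>mark\<close>.\<close>
  define r where "r n = psnd (f (LEAST b. pfst (f b) = mark n i))" for n
  have ex_mark: "\<exists>b. pfst (f b) = mark n i" for n
    unfolding f using mark_attached[OF i(1)] surj by metis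
  have r: "h (r n) = root n" for n
    unfolding r_def f(2) using LeastI_ex[OF ex_mark, unfolded f] unfolding f by (rule owner_mark)
  have "computable_from Y (\<lambda>n. LEAST b. pfst (f b) = mark n i)"
    by (rule computable_Least[OF _ ex_mark])
      (unfold mark_def, intro computable_intros decidable_comp[OF i(2)] computable_from_comp[OF comp_f])
  then have comp_r: "computable_from Y r"
    unfolding r_def by (intro computable_intros computable_from_comp[OF comp_f])
  \<comment> \<open>Agrees with \<open>h\<close> on base elements, which is all that is asked of
    it.\<close>
  define g where "g b = (let n = psnd (pfst (f b)) in if b = r n then root n else twin n)" for b
  have comp_g: "computable_from Y g"
    unfolding g_def Let_def
    by (intro computable_intros computable_from_comp[OF comp_f] computable_from_comp[OF comp_r])
  have g: "g b = h b" if b: "kind (h b) = prod_encode (0, n)" for b n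
  proof -
    have "b = r n \<longleftrightarrow> h b = root n" using r[of n] h_eq[of b "r n"] by auto
    then show ?thesis using b[unfolded kind_base] by (auto simp: g_def f b)
  qed
  have g_owner: "g (psnd (f b)) = owner (h b)" for b
    using g[of "psnd (f b)"] kind_owner by (simp add: f)
  have "h b = (LEAST a. kind a = pfst (f b) \<and> owner a = g (psnd (f b)))" for b
  proof -
    have "a = h b" if "kind a = kind (h b) \<and> owner a = owner (h b)" for a
      using that element_unique by blast
    then show ?thesis unfolding g_owner f(1) by (intro Least_equality[symmetric]) auto
  qed
  moreover have "computable_from Y (\<lambda>b. LEAST a. kind a = pfst (f b) \<and> owner a = g (psnd (f b)))"
  proof (rule computable_Least)
    show "\<exists>a. kind a = pfst (f b) \<and> owner a = g (psnd (f b))" for b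
      unfolding g_owner f(1) by blast
  qed (intro computable_intros computable_from_comp[OF comp_f] computable_from_comp[OF comp_g])
  ultimately show ?thesis by presburger
qed

end

section \<open>Coded lists and generic permutations\<close>

text \<open>Total access with default 0, so that it is a computable function of code and
  index.\<close>

definition item :: "nat list \<Rightarrow> nat \<Rightarrow> nat" where
  "item xs j = (if j < length xs then xs ! j else 0)"

text \<open>Like \<open>distinct_item\<close>, this yields bounded quantifiers over
  \<open>item\<close>, which the decidability rules can handle.\<close>

lemma prefix_item:
  "prefix xs ys \<longleftrightarrow> length xs \<le> length ys \<and> (\<forall>j<length xs. item ys j = item xs j)"
proof
  assume *: "length xs \<le> length ys \<and> (\<forall>j<length xs. item ys j = item xs j)"
  then have "take (length xs) ys = xs"
    by (intro nth_equalityI) (auto simp: item_def)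
  then show "prefix xs ys" by (metis take_is_prefix)
qed (auto simp: prefix_def item_def nth_append)

lemma distinct_item:
  "distinct xs \<longleftrightarrow> (\<forall>i<length xs. \<forall>j<length xs. item xs i = item xs j \<longrightarrow> i = j)"
  by (auto simp: distinct_conv_nth item_def)

lemma drop_code:
  "rec_nat c (\<lambda>i v. psnd (v - 1)) j = list_encode (drop j (list_decode c))"
proof (induction j)
  case (Suc j)
  \<comment> \<open>The empty list has code 0, fixed by predecessor and \<open>psnd\<close>, so the
    iteration may run past the end.\<close>
  have "psnd 0 = 0" by (simp add: prod_decode_def prod_decode_aux.simps)
  then have "psnd (list_encode xs - 1) = list_encode (tl xs)" for xs
    by (cases xs) auto
  then show ?case using Suc.IH by (simp add: drop_Suc tl_drop)
qed simp

lemma decidable_less_length [computable_intros]: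
  assumes "computable_from X f" "computable_from X g"
  shows "decidable_from X (\<lambda>x. f x < length (list_decode (g x)))"
proof -
  have "decidable_from X (\<lambda>x. rec_nat (g x) (\<lambda>i v. psnd (v - 1)) (f x) \<noteq> 0)"
    by (intro computable_intros assms)
  moreover have "list_encode xs \<noteq> 0 \<longleftrightarrow> xs \<noteq> []" for xs by (cases xs) auto
  ultimately show ?thesis unfolding drop_code by (simp add: not_le)
qed

lemma computable_length [computable_intros]:
  assumes "computable_from X g"
  shows "computable_from X (\<lambda>x. length (list_decode (g x)))"
proof -
  have "length xs = (LEAST j. \<not> j < length xs)" for xs :: "nat list"
    by (rule Least_equality[symmetric]) auto
  moreover have "computable_from X (\<lambda>x. LEAST j. \<not> j < length (list_decode (g x)))"
    by (rule computable_Least)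
      (intro computable_intros computable_from_comp[OF assms], auto)
  ultimately show ?thesis by presburger
qed

lemma computable_item [computable_intros]:
  assumes "computable_from X f" "computable_from X g"
  shows "computable_from X (\<lambda>x. item (list_decode (g x)) (f x))"
proof -
  have "item xs j = (if j < length xs then pfst (list_encode (drop j xs) - 1) else 0)" for xs j
    by (auto simp: item_def Cons_nth_drop_Suc[symmetric])
  moreover have "computable_from X (\<lambda>x. if f x < length (list_decode (g x))
      then pfst (rec_nat (g x) (\<lambda>i v. psnd (v - 1)) (f x) - 1) else 0)"
    by (intro computable_intros assms)
  ultimately show ?thesis unfolding drop_code by presburger
qed

section \<open>Permutations meeting countably many requirements\<close>

definition agrees :: "(nat \<Rightarrow> nat) \<Rightarrow> nat list \<Rightarrow> bool" where
  "agrees \<pi> xs \<longleftrightarrow> (\<forall>j<length xs. \<pi> j = xs ! j)"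

text \<open>Finite extension argument: each requirement can be met above any finite injective part,
  so they are met one after the other.\<close>

lemma generic_permutation:
  fixes Q :: "nat \<Rightarrow> nat list \<Rightarrow> bool"
  assumes "\<And>e xs. distinct xs \<Longrightarrow> \<exists>ys. distinct ys \<and> prefix xs ys \<and> Q e ys"
  shows "\<exists>\<pi>. bij \<pi> \<and> (\<forall>e. \<exists>xs. agrees \<pi> xs \<and> Q e xs)"
proof -
  have "\<forall>e xs. \<exists>ys. distinct xs \<longrightarrow> distinct ys \<and> prefix xs ys \<and> Q e ys"
    using assms by blast
  then obtain F where F: "\<And>e xs. distinct xs \<Longrightarrow> distinct (F e xs) \<and> prefix xs (F e xs) \<and> Q e (F e xs)"
    by metis
  \<comment> \<open>Putting \<open>e\<close> into the range before meeting \<open>Q e\<close> makes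
    the limit surjective.\<close>
  define add where "add e xs = (if e \<in> set xs then xs else xs @ [e])" for e and xs :: "nat list"
  have add: "distinct (add e xs)" "prefix xs (add e xs)" "e \<in> set (add e xs)" if "distinct xs" for e xs
    using that by (auto simp: add_def)
  define S where "S = rec_nat [] (\<lambda>e xs. F e (add e xs))"
  have S_Suc: "S (Suc e) = F e (add e (S e))" for e by (simp add: S_def)
  have dist: "distinct (S e)" for e
    by (induction e) (simp add: S_def, simp add: S_Suc F add)
  have Q: "Q e (S (Suc e))" for e
    using F add(1) dist by (simp add: S_Suc)
  have step: "prefix (add e (S e)) (S (Suc e))" for e
    using F add(1) dist by (simp add: S_Suc)
  have mem: "e \<in> set (S (Suc e))" for e
    using set_mono_prefix[OF step] add(3) dist by blast
  have mono: "prefix (S m) (S n)" if "m \<le> n" for m n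
    using that
  proof (induction n rule: dec_induct)
    case (step n)
    then show ?case using \<open>prefix (add n (S n)) (S (Suc n))\<close> add(2)[OF dist] prefix_order.trans by blast
  qed simp
  \<comment> \<open>Stage \<open>n\<close> contains all numbers below \<open>n\<close>, so its
    length is at least \<open>n\<close> and the limit is defined everywhere.\<close>
  have len: "n \<le> length (S n)" for n
  proof -
    have "{..<n} \<subseteq> set (S n)"
    proof
      fix e assume "e \<in> {..<n}"
      then show "e \<in> set (S n)" using mem[of e] set_mono_prefix[OF mono[of "Suc e" n]] by auto
    qed
    then have "card {..<n} \<le> card (set (S n))" by (intro card_mono) auto
    then show ?thesis using card_length[of "S n"] by simp
  qed
  define \<pi> where "\<pi> j = S (Suc j) ! j" for j
  have nth: "S m ! j = S n ! j" if "m \<le> n" "j < length (S m)" for m n j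
    using mono[OF that(1)] that(2) by (auto simp: prefix_def nth_append)
  have agree: "agrees \<pi> (S n)" for n
    unfolding agrees_def
  proof (intro allI impI)
    fix j assume j: "j < length (S n)"
    show "\<pi> j = S n ! j"
    proof (cases "Suc j \<le> n")
      case True
      then show ?thesis using nth[of "Suc j" n j] len[of "Suc j"] unfolding \<pi>_def by simp
    next
      case False
      then show ?thesis using nth[of n "Suc j" j] j unfolding \<pi>_def by simp
    qed
  qed
  have "bij \<pi>"
  proof (rule bijI)
    show "inj \<pi>"
    proof (rule injI)
      fix i j assume eq: "\<pi> i = \<pi> j"
      let ?n = "Suc (max i j)"
      have "i < length (S ?n)" "j < length (S ?n)" using len[of ?n] by auto
      with eq agree[of ?n] show "i = j"
        unfolding agrees_def using nth_eq_iff_index_eq[OF dist] by metis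
    qed
    show "surj \<pi>"
    proof (unfold surj_def, intro allI)
      fix x
      obtain j where "j < length (S (Suc x))" "S (Suc x) ! j = x"
        using mem[of x] by (auto simp: in_set_conv_nth)
      then show "\<exists>j. x = \<pi> j" using agree[of "Suc x"] unfolding agrees_def by metis
    qed
  qed
  then show ?thesis using Q agree by blast
qed

section \<open>Generic copies\<close>

context firing
begin

definition copy_oracle :: "(nat \<Rightarrow> nat) \<Rightarrow> nat set \<Rightarrow> nat set" where
  "copy_oracle \<pi> X = turing_join (rel_graph (copy \<pi>)) X"

text \<open>Even queries concern the copy and are answered if both elements lie in the finite part
  \<open>xs\<close>; odd ones concern \<open>X\<close> and are always answered. The values 1 and 2
  mean "no" and "yes".\<close>

definition known :: "nat set \<Rightarrow> nat list \<Rightarrow> nat \<Rightarrow> nat" where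
  "known X xs q =
    (if q mod 2 = 0 then
       (if pfst (psnd (q div 2)) < length xs \<and> psnd (psnd (q div 2)) < length xs then
          (if kind (item xs (pfst (psnd (q div 2)))) = pfst (q div 2) \<and>
              owner (item xs (pfst (psnd (q div 2)))) = item xs (psnd (psnd (q div 2))) then 2 else 1)
        else 0)
     else (if q div 2 \<in> X then 2 else 1))"

lemma computable_known: "computable_from X (\<lambda>z. known X (list_decode (pfst z)) (psnd z))"
  unfolding known_def
  by (intro computable_intros computable_from_comp[OF computable_from_parity]
      decidable_comp[OF turing_le_refl[unfolded turing_le_iff_decidable]])

lemma known_sound:
  assumes "agrees \<pi> xs"
  shows "known X xs q = 0 \<or> known X xs q = Suc (if q \<in> copy_oracle \<pi> X then 1 else 0)"
  using assms
  by (auto simp: known_def copy_oracle_def turing_join_iff rel_graph_def copy_def agrees_def item_def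
      even_iff_mod_2_eq_zero)

text \<open>The components of a pair do not exceed its code, so a query below \<open>N\<close>
  mentions only elements below \<open>N\<close>.\<close>

lemma answers_known:
  assumes "\<And>q. q \<in> F \<Longrightarrow> q < N"
  shows "answers (copy_oracle \<pi> X) F (known X (map \<pi> [0..<N]))"
  unfolding answers_def
proof
  fix q assume "q \<in> F"
  have 1: "pfst z \<le> z" "psnd z \<le> z" for z
    using le_prod_encode_1[of "pfst z" "psnd z"] le_prod_encode_2[of "psnd z" "pfst z"] by auto
  have "pfst (psnd (q div 2)) \<le> q" "psnd (psnd (q div 2)) \<le> q"
    using 1[of "q div 2"] 1[of "psnd (q div 2)"] by auto
  with assms[OF \<open>q \<in> F\<close>] have "pfst (psnd (q div 2)) < N" "psnd (psnd (q div 2)) < N" by auto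
  then show "known X (map \<pi> [0..<N]) q = Suc (if q \<in> copy_oracle \<pi> X then 1 else 0)"
    by (auto simp: known_def copy_oracle_def turing_join_iff rel_graph_def copy_def item_def
        even_iff_mod_2_eq_zero)
qed

section \<open>Exchanging the root and the twin of a component\<close>

definition new_witness :: "nat \<Rightarrow> nat \<Rightarrow> bool" where
  "new_witness n e \<longleftrightarrow> pfst (kind e) = 2 \<and> pfst (psnd (kind e)) = n"

text \<open>If everything fires, the remaining witnesses of root and twin match, and only the new
  ones tell the two apart. Component 0 is excluded because the padding is attached to its
  root.\<close>

lemma swap_component:
  assumes n: "n \<noteq> 0" and all: "\<forall>i<k. fires n i"
  shows "\<exists>\<theta>. inj_on \<theta> {e. \<not> new_witness n e} \<and>
    (\<forall>e. \<not> new_witness n e \<longrightarrow> kind (\<theta> e) = kind e) \<and>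
    (\<forall>e e'. \<not> new_witness n e \<longrightarrow> \<not> new_witness n e' \<longrightarrow> (owner (\<theta> e) = \<theta> e' \<longleftrightarrow> owner e = e')) \<and>
    \<theta> (root n) = twin n \<and>
    (\<forall>e. psnd (owner e) \<noteq> n \<longrightarrow> \<theta> e = e)"
proof -
  \<comment> \<open>The swap on base elements; \<open>\<theta>\<close> will keep the kind and apply
    \<open>\<rho>\<close> to the owner.\<close>
  define \<rho> where "\<rho> c = (if c = root n then twin n else if c = twin n then root n else c)" for c
  have \<rho>\<rho>: "\<rho> (\<rho> c) = c" for c by (auto simp: \<rho>_def)
  have "\<exists>e'. kind e' = kind e \<and> owner e' = \<rho> (owner e)" if e: "\<not> new_witness n e" for e
  proof (cases "owner e = root n \<or> owner e = twin n")
    case False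
    then show ?thesis by (intro exI[of _ e]) (auto simp: \<rho>_def)
  next
    case True
    show ?thesis
    proof (cases e rule: element_cases)
      case (root m)
      with True show ?thesis by (intro exI[of _ "twin n"]) (auto simp: \<rho>_def)
    next
      case (twin m)
      with True show ?thesis by (intro exI[of _ "root n"]) (auto simp: \<rho>_def)
    next
      case (old m i)
      \<comment> \<open>Firing supplies the matching witness at the twin.\<close>
      with True all obtain s where m: "m = n" and s: "live (prod_encode (n, i)) s"
        unfolding fires_def by auto
      show ?thesis unfolding old(3,4) m using live_simps(1,2)[OF s] by (auto simp: \<rho>_def)
    next
      case (copied m i s)
      with True have m: "m = n" by auto
      have "i < k" using live_less[OF copied(2)] by simp
      then show ?thesis unfolding copied(3,4) m
        by (intro exI[of _ "prod_encode (2, prod_encode (n, i))"]) (auto simp: \<rho>_def)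
    next
      case (new m i s)
      with True e show ?thesis by (auto simp: new_witness_def)
    next
      case padding
      with True n show ?thesis by auto
    qed
  qed
  then obtain \<theta> where \<theta>: "\<And>e. \<not> new_witness n e \<Longrightarrow> kind (\<theta> e) = kind e \<and> owner (\<theta> e) = \<rho> (owner e)"
    by metis
  have fixes_c: "\<theta> e = c" if "\<not> new_witness n e" "kind c = kind e" "owner c = \<rho> (owner e)" for e c
    using \<theta>[OF that(1)] that(2,3) by (intro element_unique[of "\<theta> e" c]) auto
  have inj: "e = e'" if "\<not> new_witness n e" "\<not> new_witness n e'" "\<theta> e = \<theta> e'" for e e'
  proof (rule element_unique)
    show "kind e = kind e'" using \<theta>[OF that(1)] \<theta>[OF that(2)] that(3) by metis
    show "owner e = owner e'" using \<theta>[OF that(1)] \<theta>[OF that(2)] that(3) \<rho>\<rho> by metis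
  qed
  have base: "\<not> new_witness n (owner e)" for e
    by (simp add: new_witness_def kind_owner)
  have \<theta>_owner: "\<theta> (owner e) = \<rho> (owner e)" for e
  proof (rule fixes_c[OF base])
    show "kind (\<rho> (owner e)) = kind (owner e)" by (simp add: \<rho>_def)
    show "owner (\<rho> (owner e)) = \<rho> (owner (owner e))" by (simp add: \<rho>_def)
  qed
  show ?thesis
  proof (intro exI[of _ \<theta>] conjI allI impI)
    show "inj_on \<theta> {e. \<not> new_witness n e}" by (rule inj_onI) (use inj in auto)
    show "kind (\<theta> e) = kind e" if "\<not> new_witness n e" for e using \<theta>[OF that] by blast
    show "owner (\<theta> e) = \<theta> e' \<longleftrightarrow> owner e = e'" if "\<not> new_witness n e" "\<not> new_witness n e'" for e e'
    proof -
      have "owner (\<theta> e) = \<theta> (owner e)" using \<theta>[OF that(1)] \<theta>_owner by metis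
      then show ?thesis using inj[OF base that(2), of e] by metis
    qed
    show "\<theta> (root n) = twin n" using \<theta>_owner[of "root n"] by (simp add: \<rho>_def)
    show "\<theta> e = e" if "psnd (owner e) \<noteq> n" for e
    proof (rule fixes_c)
      show "\<not> new_witness n e"
        using that by (cases e rule: element_cases) (auto simp: new_witness_def)
      show "owner e = \<rho> (owner e)" using that by (auto simp: \<rho>_def)
    qed simp
  qed
qed

text \<open>
  If all isomorphisms that the program computes from copies extending \<open>\<sigma>\<close> are right, then a finite part
  \<open>\<tau>\<close> that makes it find the root of a component without containing a witness of kind \<open>(2, n, i)\<close>
  certifies that not everything fires there: otherwise swapping root and twin in \<open>\<tau>\<close> would go unnoticed.
  Component \<open>(t, d)\<close> stands for the tuple coded by \<open>t\<close>; the parameter \<open>d\<close> serves to find, for every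
  tuple, a component that \<open>\<sigma>\<close> does not meet.
\<close>

lemma force_wrong_isomorphism:
  assumes W: "\<And>i. i < k \<Longrightarrow> semidecidable_from X (W i)"
    and fires: "\<And>n i. i < k \<Longrightarrow> fires n i \<longleftrightarrow> W i (coord i (pfst n))"
    and undec: "\<And>i. i < k \<Longrightarrow> \<not> decidable_from X (W i)"
    and \<sigma>: "distinct \<sigma>"
  shows "\<exists>\<tau>. distinct \<tau> \<and> prefix \<sigma> \<tau> \<and>
    (\<forall>\<pi>. bij \<pi> \<longrightarrow> agrees \<pi> \<tau> \<longrightarrow> \<not> (\<forall>b. computes (copy_oracle \<pi> X) p b (\<pi> b)))"
proof (rule ccontr)
  assume "\<not> ?thesis"
  then have total: "\<exists>\<pi>. bij \<pi> \<and> agrees \<pi> \<tau> \<and> (\<forall>b. computes (copy_oracle \<pi> X) p b (\<pi> b))"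
    if "distinct \<tau>" "prefix \<sigma> \<tau>" for \<tau>
    using that by blast
  \<comment> \<open>\<open>\<tau>\<close> is part of a copy on which \<open>p\<close> computes the
    true isomorphism, so a halting run on \<open>\<tau>\<close> cannot give a wrong value.\<close>
  have correct: "\<tau> ! b = m"
    if \<tau>: "distinct \<tau>" "prefix \<sigma> \<tau>" and b: "b < length \<tau>" and m: "run (known X \<tau>) s p b = Suc m"
    for \<tau> s b m
  proof -
    obtain \<pi> where \<pi>: "agrees \<pi> \<tau>" "computes (copy_oracle \<pi> X) p b (\<pi> b)"
      using total[OF \<tau>] by blast
    have "computes (copy_oracle \<pi> X) p b m"
      by (rule run_sound[OF known_sound[OF \<pi>(1)] m])
    with \<pi> b show ?thesis unfolding agrees_def using computes_deterministic by metis
  qed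
  obtain \<pi> where bij: "bij \<pi>" and \<pi>: "agrees \<pi> \<sigma>" "\<And>b. computes (copy_oracle \<pi> X) p b (\<pi> b)"
    using total[OF \<sigma>] by blast
  have "finite (insert 0 ((\<lambda>e. psnd (owner e)) ` set \<sigma>))" by simp
  \<comment> \<open>The components \<open>(t, d)\<close> have codes at least \<open>d\<close>, so
    they are nonzero and lie beyond those met by \<open>\<sigma>\<close>.\<close>
  then obtain d where d: "0 < d" "\<And>e. e \<in> set \<sigma> \<Longrightarrow> psnd (owner e) < d"
    unfolding finite_nat_set_iff_bounded by auto
  define c where "c t = prod_encode (t, d)" for t
  have c: "d \<le> c t" for t unfolding c_def by (rule le_prod_encode_2)
  define R where "R t z \<longleftrightarrow> (let \<tau> = list_decode (pfst z); s = pfst (psnd z); b = psnd (psnd z) in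
      distinct \<tau> \<and> prefix \<sigma> \<tau> \<and> (\<forall>j<length \<tau>. \<not> new_witness (c t) (item \<tau> j)) \<and>
      b < length \<tau> \<and> run (known X \<tau>) s p b = Suc (root (c t)))" for t z
  have "\<exists>i<k. decidable_from X (W i)"
  proof (rule decidable_factor_if_separated[where V = "\<lambda>t. \<exists>z. R t z", OF _ W])
    have R_eq: "R t z \<longleftrightarrow>
      (\<forall>i<length (list_decode (pfst z)). \<forall>j<length (list_decode (pfst z)).
        item (list_decode (pfst z)) i = item (list_decode (pfst z)) j \<longrightarrow> i = j) \<and>
      (length \<sigma> \<le> length (list_decode (pfst z)) \<and>
        (\<forall>j<length \<sigma>. item (list_decode (pfst z)) j = item (list_decode (list_encode \<sigma>)) j)) \<and>
      (\<forall>j<length (list_decode (pfst z)).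
        \<not> (pfst (kind (item (list_decode (pfst z)) j)) = 2 \<and>
           pfst (psnd (kind (item (list_decode (pfst z)) j))) = prod_encode (t, d))) \<and>
      psnd (psnd z) < length (list_decode (pfst z)) \<and>
      run (known X (list_decode (pfst z))) (pfst (psnd z)) p (psnd (psnd z)) =
        Suc (prod_encode (0, prod_encode (t, d)))" for t z
      unfolding R_def Let_def distinct_item prefix_item new_witness_def c_def list_encode_inverse ..
    have "decidable_from X (\<lambda>z. R (pfst z) (psnd z))"
      unfolding R_eq
      by (intro computable_intros computable_run[where \<alpha> = "\<lambda>c. known X (list_decode c)"]
          computable_known)
    then show "semidecidable_from X (\<lambda>t. \<exists>z. R t z)" by (rule semidecidableI) simp
  next
    fix t assume "\<And>i. i < k \<Longrightarrow> \<not> W i (coord i t)"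
    \<comment> \<open>Nothing fires, so the component has no new witness and a long enough initial
      part of \<open>\<pi>\<close> is a certificate.\<close>
    then have none: "\<not> fires (c t) i" if "i < k" for i using that fires[OF that] by (simp add: c_def)
    have no_new: "\<not> new_witness (c t) e" for e
    proof (cases e rule: element_cases)
      case (new m i s)
      have "i < k" using live_less[OF new(2)] by simp
      then show ?thesis using none[of i] new by (auto simp: new_witness_def fires_def)
    qed (auto simp: new_witness_def)
    obtain b where b: "\<pi> b = root (c t)" using surjD[OF bij_is_surj[OF bij]] by metis
    obtain F s where F: "finite F"
      "\<And>\<alpha>. answers (copy_oracle \<pi> X) F \<alpha> \<Longrightarrow> run \<alpha> s p b = Suc (root (c t))"
      using run_complete[OF \<pi>(2)[of b]] unfolding b by blast
    have "finite (insert b (insert (length \<sigma>) F))" using F(1) by simp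
    then obtain N where N: "b < N" "length \<sigma> < N" "\<And>q. q \<in> F \<Longrightarrow> q < N"
      unfolding finite_nat_set_iff_bounded by auto
    let ?\<tau> = "map \<pi> [0..<N]"
    have "run (known X ?\<tau>) s p b = Suc (root (c t))" by (intro F(2) answers_known N(3))
    moreover have "distinct ?\<tau>"
      using inj_on_subset[OF bij_is_inj[OF bij], of "{0..<N}"] by (simp add: distinct_map)
    moreover have "prefix \<sigma> ?\<tau>"
      using \<pi>(1) N(2) by (auto simp: prefix_item item_def agrees_def)
    ultimately have "R t (prod_encode (list_encode ?\<tau>, prod_encode (s, b)))"
      unfolding R_def using N(1) no_new by simp
    then show "\<exists>z. R t z" by blast
  next
    fix t assume "\<exists>z. R t z"
    then obtain \<tau> s b where \<tau>: "distinct \<tau>" "prefix \<sigma> \<tau>" "\<And>j. j < length \<tau> \<Longrightarrow> \<not> new_witness (c t) (\<tau> ! j)"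
      and b: "b < length \<tau>" and run: "run (known X \<tau>) s p b = Suc (root (c t))"
      unfolding R_def Let_def item_def by force
    show "\<exists>i<k. \<not> W i (coord i t)"
    proof (rule ccontr)
      assume "\<not> ?thesis"
      then have all: "\<forall>i<k. fires (c t) i" using fires by (simp add: c_def)
      have nonzero: "c t \<noteq> 0" using c[of t] d(1) by simp
      obtain \<theta> where \<theta>: "inj_on \<theta> {e. \<not> new_witness (c t) e}"
        "\<forall>e. \<not> new_witness (c t) e \<longrightarrow> kind (\<theta> e) = kind e"
        "\<forall>e e'. \<not> new_witness (c t) e \<longrightarrow> \<not> new_witness (c t) e' \<longrightarrow>
          (owner (\<theta> e) = \<theta> e' \<longleftrightarrow> owner e = e')"
        "\<theta> (root (c t)) = twin (c t)"
        "\<forall>e. psnd (owner e) \<noteq> c t \<longrightarrow> \<theta> e = e"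
        using swap_component[OF nonzero all] by (elim exE conjE) (rule that)
      have "set \<tau> \<subseteq> {e. \<not> new_witness (c t) e}" using \<tau>(3) by (auto simp: in_set_conv_nth)
      then have "distinct (map \<theta> \<tau>)"
        using \<tau>(1) \<theta>(1) by (simp add: distinct_map inj_on_subset)
      moreover have "map \<theta> \<sigma> = \<sigma>"
      proof (rule map_idI)
        fix e assume "e \<in> set \<sigma>"
        then have "psnd (owner e) < c t" using d(2) c[of t] order_less_le_trans by blast
        then show "\<theta> e = e" using \<theta>(5) by simp
      qed
      then have "prefix \<sigma> (map \<theta> \<tau>)" using map_mono_prefix[OF \<tau>(2), of \<theta>] by simp
      \<comment> \<open>Queries see only kinds and attachment, so the run still announces the root,
        but position \<open>b\<close> now holds the twin.\<close>
      moreover have "known X (map \<theta> \<tau>) = known X \<tau>"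
        by (rule ext) (simp add: known_def item_def \<theta>(2,3) \<tau>(3))
      ultimately have "map \<theta> \<tau> ! b = root (c t)" using correct[of "map \<theta> \<tau>" b s] b run by simp
      moreover have "\<tau> ! b = root (c t)" by (rule correct[OF \<tau>(1,2) b run])
      ultimately show False using \<theta>(4) b by simp
    qed
  qed
  then show False using undec by blast
qed

text \<open>There is one requirement per program, and \<open>force_wrong_isomorphism\<close> shows
  that each can be met above any finite part.\<close>

lemma exists_generic_copy:
  assumes "\<And>i. i < k \<Longrightarrow> semidecidable_from X (W i)"
    and "\<And>n i. i < k \<Longrightarrow> fires n i \<longleftrightarrow> W i (coord i (pfst n))"
    and "\<And>i. i < k \<Longrightarrow> \<not> decidable_from X (W i)"
  shows "\<exists>\<pi>. bij \<pi> \<and> \<not> computable_from (copy_oracle \<pi> X) \<pi>"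
proof -
  define Q where "Q e \<tau> \<longleftrightarrow> (\<forall>\<pi>. bij \<pi> \<longrightarrow> agrees \<pi> \<tau> \<longrightarrow>
    \<not> (\<forall>b. computes (copy_oracle \<pi> X) (inv program_code e) b (\<pi> b)))" for e \<tau>
  have "\<exists>\<tau>. distinct \<tau> \<and> prefix \<sigma> \<tau> \<and> Q e \<tau>" if "distinct \<sigma>" for e \<sigma>
    unfolding Q_def using assms that by (rule force_wrong_isomorphism)
  then obtain \<pi> where \<pi>: "bij \<pi>" "\<And>e. \<exists>\<tau>. agrees \<pi> \<tau> \<and> Q e \<tau>"
    using generic_permutation[of Q] by blast
  have "\<not> (\<forall>b. computes (copy_oracle \<pi> X) p b (\<pi> b))" for p
    using \<pi>(2)[of "program_code p"] \<pi>(1) unfolding Q_def inv_f_f[OF inj_program_code] by blast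
  then show ?thesis using \<pi>(1) unfolding computable_from_def by blast
qed

end

section \<open>The theorem\<close>

text \<open>Turns enumerations of the \<open>W i\<close> into stages. Component \<open>n\<close>
  stands for the tuple \<open>pfst n\<close>; \<open>psnd n\<close> is a free parameter.\<close>

lemma exists_firing:
  assumes k: "0 < k" and W: "\<And>i. i < k \<Longrightarrow> semidecidable_from {} (W i)"
  obtains live where "firing k live"
    "\<And>n i. i < k \<Longrightarrow> firing.fires live n i \<longleftrightarrow> W i (coord i (pfst n))"
proof -
  have "\<exists>R. decidable_from {} (\<lambda>z. R (pfst z) (psnd z)) \<and> (\<forall>n. W i n \<longleftrightarrow> (\<exists>s. R n s))" if "i < k" for i
    using W[OF that] unfolding semidecidable_from_def .
  then obtain R where R: "\<And>i. i < k \<Longrightarrow> decidable_from {} (\<lambda>z. R i (pfst z) (psnd z))"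
    "\<And>i n. i < k \<Longrightarrow> W i n \<longleftrightarrow> (\<exists>s. R i n s)"
    by metis
  define L where "L m s \<longleftrightarrow> psnd m < k \<and> R (psnd m) (coord (psnd m) (pfst (pfst m))) s" for m s
  \<comment> \<open>Keeping only the first stage gives uniqueness.\<close>
  define live where "live m s \<longleftrightarrow> L m s \<and> (\<forall>s'<s. \<not> L m s')" for m s
  have L: "decidable_from {} (\<lambda>z. L (pfst z) (psnd z))"
    unfolding L_def
  proof (rule decidable_case_less[where f = "\<lambda>z. psnd (pfst z)"
        and P = "\<lambda>i z. R i (coord i (pfst (pfst (pfst z)))) (psnd z)"])
    show "decidable_from {} (\<lambda>z. R i (coord i (pfst (pfst (pfst z)))) (psnd z))" if "i < k" for i
      by (intro decidable_comp2[OF R(1)[OF that]] computable_intros)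
  qed (intro computable_intros)
  have firing: "firing k live"
  proof
    show "0 < k" by (rule k)
    show "decidable_from {} (\<lambda>z. live (pfst z) (psnd z))"
      unfolding live_def by (intro computable_intros decidable_comp2[OF L])
    show "s = s'" if "live m s" "live m s'" for m s s'
      using that unfolding live_def by (metis linorder_neqE_nat)
    show "psnd m < k" if "live m s" for m s
      using that unfolding live_def L_def by blast
  qed
  show thesis
  proof (rule that[OF firing])
    fix n i assume i: "i < k"
    have "(\<exists>s. live m s) \<longleftrightarrow> (\<exists>s. L m s)" for m
      unfolding live_def using exists_least_iff[of "L m"] by blast
    then show "firing.fires live n i \<longleftrightarrow> W i (coord i (pfst n))"
      unfolding firing.fires_def[OF firing] by (simp add: L_def R(2) i)
  qed
qed

theorem corollary2:
  fixes k :: nat and a :: "nat \<Rightarrow> turing_degree"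
  assumes "k \<ge> 1"
    and "\<forall>i\<in>{1..k}. ce_degree (a i)"
  shows "\<exists>L A. computable_structure L A \<and> rigid_structure L A \<and>
    (\<forall>x. relatively_computably_categorical x L A \<longleftrightarrow> (\<exists>i\<in>{1..k}. a i \<le> x))"
proof -
  \<comment> \<open>The degrees are indexed from 1, the coordinates from 0, hence the shift by
    \<open>Suc\<close>.\<close>
  have "\<forall>i<k. \<exists>W. ce_set W \<and> a (Suc i) = turing_degree_of W"
    using assms(2) unfolding ce_degree_def by auto
  then obtain W where W: "\<And>i. i < k \<Longrightarrow> ce_set (W i)" "\<And>i. i < k \<Longrightarrow> a (Suc i) = turing_degree_of (W i)"
    by metis
  have semi: "semidecidable_from X (\<lambda>n. n \<in> W i)" if "i < k" for X i
    using W(1)[OF that] by (rule ce_set_semidecidable)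
  have "0 < k" using assms(1) by simp
  then obtain live where "firing k live"
    and fires: "\<And>n i. i < k \<Longrightarrow> firing.fires live n i \<longleftrightarrow> coord i (pfst n) \<in> W i"
    using exists_firing[of k "\<lambda>i n. n \<in> W i"] semi by metis
  interpret firing k live by fact
  let ?L = binary_language and ?A = "copy id"
  have a_le: "(\<exists>i\<in>{1..k}. a i \<le> turing_degree_of X) \<longleftrightarrow> (\<exists>i<k. decidable_from X (\<lambda>n. n \<in> W i))" for X
  proof -
    have "{1..k} = Suc ` {..<k}" by (simp add: image_Suc_lessThan)
    then show ?thesis
      by (auto simp: W(2) less_eq_turing_degree.abs_eq turing_le_iff_decidable)
  qed
  have "relatively_computably_categorical (turing_degree_of X) ?L ?A \<longleftrightarrow>
      (\<exists>i<k. decidable_from X (\<lambda>n. n \<in> W i))" (is "?cat \<longleftrightarrow> ?dec") for X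
  proof
    assume ?dec
    then obtain i where i: "i < k" "turing_le (W i) X" unfolding turing_le_iff_decidable by blast
    show ?cat
      unfolding relatively_computably_categorical_def isomorphic_structures_def
    proof (intro allI impI, elim exE)
      fix B h assume h: "is_isomorphism ?L B ?A h"
      let ?Y = "turing_join (atomic_diagram ?L B) X"
      have "decidable_from ?Y (\<lambda>n. n \<in> W i)"
        using turing_le_trans[OF i(2) turing_le_join2] unfolding turing_le_iff_decidable .
      then have "decidable_from ?Y (\<lambda>n. fires n i)"
        unfolding fires[OF i(1)] by (rule decidable_comp) (intro computable_intros)
      then have "computable_from ?Y h"
        by (rule computable_isomorphism[OF h i(1)])
          (rule turing_le_trans[OF rel_graph_le_atomic_diagram turing_le_join1])
      then have "degree_computable (sup (structure_degree ?L B) (turing_degree_of X)) h"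
        by (simp add: structure_degree_def sup_turing_degree.abs_eq degree_computable.abs_eq)
      with h show "\<exists>h. degree_computable (sup (structure_degree ?L B) (turing_degree_of X)) h \<and>
          is_isomorphism ?L B ?A h"
        by blast
    qed
  next
    assume cat: ?cat
    show ?dec
    proof (rule ccontr)
      assume "\<not> ?dec"
      then obtain \<pi> where \<pi>: "bij \<pi>" "\<not> computable_from (copy_oracle \<pi> X) \<pi>"
        using exists_generic_copy[of X "\<lambda>i n. n \<in> W i", OF semi fires] by blast
      note iso = isomorphism_copy[OF \<pi>(1)]
      then obtain h where h: "is_isomorphism ?L (copy \<pi>) ?A h"
        and "degree_computable (sup (structure_degree ?L (copy \<pi>)) (turing_degree_of X)) h"
        using cat unfolding relatively_computably_categorical_def isomorphic_structures_def by blast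
      \<comment> \<open>Isomorphisms onto \<open>copy id\<close> are unique, so the computable one
        is \<open>\<pi>\<close> itself.\<close>
      then have "computable_from (turing_join (atomic_diagram ?L (copy \<pi>)) X) \<pi>"
        using isomorphism_unique[OF h iso]
        by (simp add: structure_degree_def sup_turing_degree.abs_eq degree_computable.abs_eq)
      moreover have "turing_le (turing_join (atomic_diagram ?L (copy \<pi>)) X) (copy_oracle \<pi> X)"
        unfolding copy_oracle_def
        by (intro turing_join_least turing_le_join2
            turing_le_trans[OF atomic_diagram_le_rel_graph turing_le_join1])
      ultimately show False using \<pi>(2) computable_from_trans by blast
    qed
  qed
  \<comment> \<open>Every degree is the class of its representative, so treating
    \<open>turing_degree_of X\<close> suffices.\<close>
  then have "relatively_computably_categorical x ?L ?A \<longleftrightarrow> (\<exists>i\<in>{1..k}. a i \<le> x)" for x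
    using a_le[of "rep_turing_degree x"] Quotient_abs_rep[OF Quotient_turing_degree, of x] by metis
  then show ?thesis using computable_structure_copy_id rigid_copy_id by blast
qed

end
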